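(* In the category $\mathbf{Top}$ of all topological spaces: (a) For each space $X$ let $K(X)$ be the collection of families $\{A_\alpha\to X\}_{\alpha\in\mathcal{A}}$ such that the induced map $\coprod_{\alpha\in\mathcal{A}}A_\alpha\to X$ is a universal quotient map. Then $K$ is a Grothendieck basis generating the canonical topology on $\mathbf{Top}$. (b) A sieve $S$ on $X$ is a colim sieve if and only if there exists some collection $\{A_\alpha\to X\}_{\alpha\in\mathcal{A}}\subset S$ such that $\coprod_{\alpha\in\mathcal{A}}A_\alpha\to X$ is a quotient map; and $S$ is a universal colim sieve if and only if there exists some collection $\{A_\alpha\to X\}_{\alpha\in\mathcal{A}}\subset S$ such that $\coprod_{\alpha\in\mathcal{A}}A_\alpha\to X$ is a universal quotient map. (c) In particular, for a continuous map $f\colon Y\to X$, the sieve $T=\langle\{f\colon Y\to X\}\rangle$ is a colim sieve if and only if $f$ is a quotient map, and is a universal colim sieve if and only if $f$ is a universal quotient map.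
   Context: A quotient map is called universal if every pullback of it along a continuous map (in $\mathbf{Top}$) is a quotient map. A sieve $S$ on an object $X$ of a category is a collection of morphisms with codomain $X$ closed under precomposition; it is regarded as a full subcategory of the overcategory of $X$, with forgetful functor $U$ sending a morphism to its domain. For $f\colon Y\to X$, $f^\ast S=\{h \text{ with codomain } Y : f\circ h\in S\}$. $\langle\{A_\alpha\to X\}\rangle$ denotes the sieve generated by the family, i.e. all morphisms to $X$ factoring through a member of the family. $S$ is a colim sieve if $\operatorname{colim}_S U$ exists and the canonical map $\operatorname{colim}_S U\to X$ is an isomorphism; it is a universal colim sieve if $\alpha^\ast S$ is a colim sieve on $Y$ for every morphism $\alpha\colon Y\to X$. The canonical topology is the largest Grothendieck topology for which all representable presheaves are sheaves (equivalently, the collection of all universal colim sieves). A Grothendieck basis is a basis for a Grothendieck topology (pretopology) in the sense of Mac Lane–Moerdijk; it generates the topology whose covering sieves are those containing a family in the basis. Families are indexed by sets. *)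

theory Defs
  imports "HOL-Analysis.Analysis"
begin

section \<open>Categories, sieves and Grothendieck topologies\<close>

record ('o, 'm) cat =
  Obj :: "'o set"
  Mor :: "'m set"
  Dom :: "'m \<Rightarrow> 'o"
  Cod :: "'m \<Rightarrow> 'o"
  Id :: "'o \<Rightarrow> 'm"
  Comp :: "'m \<Rightarrow> 'm \<Rightarrow> 'm"  \<comment> \<open>\<open>Comp C g f\<close> is \<open>g\<close> after \<open>f\<close>\<close>

definition category :: "('o, 'm) cat \<Rightarrow> bool" where
  "category C \<longleftrightarrow>
    (\<forall>f\<in>Mor C. Dom C f \<in> Obj C \<and> Cod C f \<in> Obj C) \<and>
    (\<forall>X\<in>Obj C. Id C X \<in> Mor C \<and> Dom C (Id C X) = X \<and> Cod C (Id C X) = X) \<and>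
    (\<forall>f\<in>Mor C. \<forall>g\<in>Mor C. Cod C f = Dom C g \<longrightarrow>
        Comp C g f \<in> Mor C \<and> Dom C (Comp C g f) = Dom C f \<and> Cod C (Comp C g f) = Cod C g) \<and>
    (\<forall>f\<in>Mor C. Comp C f (Id C (Dom C f)) = f \<and> Comp C (Id C (Cod C f)) f = f) \<and>
    (\<forall>f\<in>Mor C. \<forall>g\<in>Mor C. \<forall>h\<in>Mor C. Cod C f = Dom C g \<and> Cod C g = Dom C h \<longrightarrow>
        Comp C h (Comp C g f) = Comp C (Comp C h g) f)"

definition hom :: "('o, 'm) cat \<Rightarrow> 'o \<Rightarrow> 'o \<Rightarrow> 'm set" where
  "hom C X Y = {f \<in> Mor C. Dom C f = X \<and> Cod C f = Y}"

definition iso_mor :: "('o, 'm) cat \<Rightarrow> 'm \<Rightarrow> bool" where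
  "iso_mor C f \<longleftrightarrow> f \<in> Mor C \<and>
    (\<exists>g\<in>hom C (Cod C f) (Dom C f).
        Comp C g f = Id C (Dom C f) \<and> Comp C f g = Id C (Cod C f))"

text \<open>The span \<open>p : P \<rightarrow> A\<close>, \<open>q : P \<rightarrow> Y\<close> is a pullback of the cospan
  \<open>f : A \<rightarrow> X\<close>, \<open>g : Y \<rightarrow> X\<close>; so \<open>q\<close> is the pullback of \<open>f\<close> along \<open>g\<close>.\<close>

definition is_pullback :: "('o, 'm) cat \<Rightarrow> 'm \<Rightarrow> 'm \<Rightarrow> 'm \<Rightarrow> 'm \<Rightarrow> bool" where
  "is_pullback C f g p q \<longleftrightarrow>
    f \<in> Mor C \<and> g \<in> Mor C \<and> Cod C f = Cod C g \<and>
    p \<in> Mor C \<and> q \<in> Mor C \<and> Dom C p = Dom C q \<and> Cod C p = Dom C f \<and> Cod C q = Dom C g \<and>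
    Comp C f p = Comp C g q \<and>
    (\<forall>a\<in>Mor C. \<forall>b\<in>Mor C.
        Dom C a = Dom C b \<and> Cod C a = Dom C f \<and> Cod C b = Dom C g \<and> Comp C f a = Comp C g b \<longrightarrow>
        (\<exists>!u. u \<in> hom C (Dom C a) (Dom C p) \<and> Comp C p u = a \<and> Comp C q u = b))"

definition sieve :: "('o, 'm) cat \<Rightarrow> 'o \<Rightarrow> 'm set \<Rightarrow> bool" where
  "sieve C X S \<longleftrightarrow> X \<in> Obj C \<and> (\<forall>f\<in>S. f \<in> Mor C \<and> Cod C f = X) \<and>
    (\<forall>f\<in>S. \<forall>g\<in>Mor C. Cod C g = Dom C f \<longrightarrow> Comp C f g \<in> S)"

definition pullback_sieve :: "('o, 'm) cat \<Rightarrow> 'm \<Rightarrow> 'm set \<Rightarrow> 'm set" where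
  "pullback_sieve C f S = {h \<in> Mor C. Cod C h = Dom C f \<and> Comp C f h \<in> S}"

definition generated_sieve :: "('o, 'm) cat \<Rightarrow> 'm set \<Rightarrow> 'm set" where
  "generated_sieve C R = {h. \<exists>f\<in>R. \<exists>g\<in>Mor C. Cod C g = Dom C f \<and> h = Comp C f g}"

text \<open>A sieve \<open>S\<close> on \<open>X\<close> is viewed as the full subcategory of the overcategory of \<open>X\<close> with set
  of objects \<open>S\<close>: a morphism from \<open>f\<close> to \<open>f'\<close> is a \<open>g\<close> with \<open>f' \<circ> g = f\<close>, and the forgetful
  functor \<open>U\<close> sends \<open>f\<close> to its domain and \<open>g\<close> to \<open>g\<close>.  Below are cocones and colimits of \<open>U\<close>.\<close>

definition sieve_cocone :: "('o, 'm) cat \<Rightarrow> 'm set \<Rightarrow> 'o \<Rightarrow> ('m \<Rightarrow> 'm) \<Rightarrow> bool" where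
  "sieve_cocone C S Z \<phi> \<longleftrightarrow> Z \<in> Obj C \<and>
    (\<forall>f\<in>S. \<phi> f \<in> hom C (Dom C f) Z) \<and>
    (\<forall>f\<in>S. \<forall>f'\<in>S. \<forall>g\<in>hom C (Dom C f) (Dom C f').
        Comp C f' g = f \<longrightarrow> Comp C (\<phi> f') g = \<phi> f)"

definition sieve_colimit :: "('o, 'm) cat \<Rightarrow> 'm set \<Rightarrow> 'o \<Rightarrow> ('m \<Rightarrow> 'm) \<Rightarrow> bool" where
  "sieve_colimit C S L \<iota> \<longleftrightarrow> sieve_cocone C S L \<iota> \<and>
    (\<forall>Z \<phi>. sieve_cocone C S Z \<phi> \<longrightarrow>
        (\<exists>!u. u \<in> hom C L Z \<and> (\<forall>f\<in>S. Comp C u (\<iota> f) = \<phi> f)))"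

text \<open>The morphism \<open>c\<close> below is the canonical map from the colimit to \<open>X\<close>, i.e. the one induced by
  the cocone consisting of the members of \<open>S\<close> themselves.\<close>

definition colim_sieve :: "('o, 'm) cat \<Rightarrow> 'o \<Rightarrow> 'm set \<Rightarrow> bool" where
  "colim_sieve C X S \<longleftrightarrow>
    (\<exists>L \<iota> c. sieve_colimit C S L \<iota> \<and>
        c \<in> hom C L X \<and> (\<forall>f\<in>S. Comp C c (\<iota> f) = f) \<and> iso_mor C c)"

definition universal_colim_sieve :: "('o, 'm) cat \<Rightarrow> 'o \<Rightarrow> 'm set \<Rightarrow> bool" where
  "universal_colim_sieve C X S \<longleftrightarrow>
    (\<forall>\<alpha>\<in>Mor C. Cod C \<alpha> = X \<longrightarrow> colim_sieve C (Dom C \<alpha>) (pullback_sieve C \<alpha> S))"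

definition grothendieck_topology :: "('o, 'm) cat \<Rightarrow> ('o \<Rightarrow> 'm set set) \<Rightarrow> bool" where
  "grothendieck_topology C J \<longleftrightarrow>
    (\<forall>X\<in>Obj C. \<forall>S\<in>J X. sieve C X S) \<and>
    (\<forall>X\<in>Obj C. {f \<in> Mor C. Cod C f = X} \<in> J X) \<and>
    (\<forall>g\<in>Mor C. \<forall>S\<in>J (Cod C g). pullback_sieve C g S \<in> J (Dom C g)) \<and>
    (\<forall>X\<in>Obj C. \<forall>S\<in>J X. \<forall>R. sieve C X R \<and> (\<forall>f\<in>S. pullback_sieve C f R \<in> J (Dom C f)) \<longrightarrow>
        R \<in> J X)"

record ('o, 'm, 'e) presheaf =
  PObj :: "'o \<Rightarrow> 'e set"
  PMor :: "'m \<Rightarrow> 'e \<Rightarrow> 'e"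

definition representable_presheaf :: "('o, 'm) cat \<Rightarrow> 'o \<Rightarrow> ('o, 'm, 'm) presheaf" where
  "representable_presheaf C Z = \<lparr>PObj = (\<lambda>X. hom C X Z), PMor = (\<lambda>g x. Comp C x g)\<rparr>"

definition matching_family ::
  "('o, 'm) cat \<Rightarrow> ('o, 'm, 'e) presheaf \<Rightarrow> 'm set \<Rightarrow> ('m \<Rightarrow> 'e) \<Rightarrow> bool" where
  "matching_family C P S x \<longleftrightarrow>
    (\<forall>f\<in>S. x f \<in> PObj P (Dom C f)) \<and>
    (\<forall>f\<in>S. \<forall>g\<in>Mor C. Cod C g = Dom C f \<longrightarrow> x (Comp C f g) = PMor P g (x f))"

definition is_sheaf ::
  "('o, 'm) cat \<Rightarrow> ('o \<Rightarrow> 'm set set) \<Rightarrow> ('o, 'm, 'e) presheaf \<Rightarrow> bool" where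
  "is_sheaf C J P \<longleftrightarrow>
    (\<forall>X\<in>Obj C. \<forall>S\<in>J X. \<forall>x. matching_family C P S x \<longrightarrow>
        (\<exists>!y. y \<in> PObj P X \<and> (\<forall>f\<in>S. PMor P f y = x f)))"

definition subcanonical :: "('o, 'm) cat \<Rightarrow> ('o \<Rightarrow> 'm set set) \<Rightarrow> bool" where
  "subcanonical C J \<longleftrightarrow> (\<forall>Z\<in>Obj C. is_sheaf C J (representable_presheaf C Z))"

definition is_canonical_topology :: "('o, 'm) cat \<Rightarrow> ('o \<Rightarrow> 'm set set) \<Rightarrow> bool" where
  "is_canonical_topology C J \<longleftrightarrow>
    grothendieck_topology C J \<and> subcanonical C J \<and>
    (\<forall>J'. grothendieck_topology C J' \<and> subcanonical C J' \<longrightarrow> (\<forall>X\<in>Obj C. J' X \<subseteq> J X))"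

text \<open>An indexed family \<open>(f\<^sub>i)\<^sub>i\<^sub>\<in>\<^sub>I\<close>.  Only the values of the function on \<open>I\<close> are relevant.\<close>

type_synonym ('i, 'm) family = "'i set \<times> ('i \<Rightarrow> 'm)"

definition family_on :: "('o, 'm) cat \<Rightarrow> 'o \<Rightarrow> ('i, 'm) family \<Rightarrow> bool" where
  "family_on C X F \<longleftrightarrow> (\<forall>i\<in>fst F. snd F i \<in> Mor C \<and> Cod C (snd F i) = X)"

text \<open>A basis in the sense of Mac Lane and Moerdijk.  The required pullbacks are part of the
  stability axiom.  In the transitivity axiom the composite family is naturally indexed by
  \<open>SIGMA i:I. J i\<close>; since all families are indexed by subsets of one type \<open>'i\<close>, it
  has to be re-indexed along a bijection \<open>b\<close>, which is required to exist and may be arbitrary.\<close>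

definition grothendieck_basis ::
  "('o, 'm) cat \<Rightarrow> ('o \<Rightarrow> ('i, 'm) family set) \<Rightarrow> bool" where
  "grothendieck_basis C K \<longleftrightarrow>
    (\<forall>X\<in>Obj C. \<forall>F\<in>K X. family_on C X F) \<and>
    (\<forall>i f. iso_mor C (f i) \<longrightarrow> ({i}, f) \<in> K (Cod C (f i))) \<and>
    (\<forall>g\<in>Mor C. \<forall>I f. (I, f) \<in> K (Cod C g) \<longrightarrow>
        (\<forall>i\<in>I. \<exists>p q. is_pullback C (f i) g p q) \<and>
        (\<forall>p q. (\<forall>i\<in>I. is_pullback C (f i) g (p i) (q i)) \<longrightarrow> (I, q) \<in> K (Dom C g))) \<and>
    (\<forall>X\<in>Obj C. \<forall>I f J g. (I, f) \<in> K X \<and> (\<forall>i\<in>I. (J i, g i) \<in> K (Dom C (f i))) \<longrightarrow>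
        (\<exists>L b. bij_betw (b :: 'i \<Rightarrow> 'i \<times> 'i) L (SIGMA i:I. J i)) \<and>
        (\<forall>L b h. bij_betw b L (SIGMA i:I. J i) \<and>
            (\<forall>l\<in>L. \<forall>i j. b l = (i, j) \<longrightarrow> h l = Comp C (f i) (g i j)) \<longrightarrow> (L, h) \<in> K X))"

definition generated_topology ::
  "('o, 'm) cat \<Rightarrow> ('o \<Rightarrow> ('i, 'm) family set) \<Rightarrow> 'o \<Rightarrow> 'm set set" where
  "generated_topology C K X = {S. sieve C X S \<and> (\<exists>F\<in>K X. snd F ` fst F \<subseteq> S)}"


section \<open>The category of topological spaces\<close>

text \<open>As usual, size issues are handled by a universe: a set of points of type \<open>'u\<close> is small if its
  cardinality is less than that of \<open>'u\<close>, and the cardinality of \<open>'u\<close> is assumed to be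
  an infinite regular strong limit.  Uncountability is not required: if \<open>'u\<close> is uncountable, this
  is precisely the statement that its cardinality is strongly inaccessible, and \<open>'u = nat\<close> gives
  the category of finite spaces.\<close>

definition small :: "'u set \<Rightarrow> bool" where
  "small A \<longleftrightarrow> A \<prec> (UNIV :: 'u set)"

definition universe :: "'u itself \<Rightarrow> bool" where
  "universe _ \<longleftrightarrow>
    infinite (UNIV :: 'u set) \<and>
    (\<forall>A :: 'u set. small A \<longrightarrow> Pow A \<prec> (UNIV :: 'u set)) \<and>
    (\<forall>(I :: 'u set) (A :: 'u \<Rightarrow> 'u set). small I \<and> (\<forall>i\<in>I. small (A i)) \<longrightarrow> small (\<Union>i\<in>I. A i))"

datatype 'u top_mor = Top_Mor (src: "'u topology") (fn: "'u \<Rightarrow> 'u") (tgt: "'u topology")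

definition Top :: "('u topology, 'u top_mor) cat" where
  "Top = \<lparr>
    Obj = {X. small (topspace X)},
    Mor = {f. small (topspace (src f)) \<and> small (topspace (tgt f)) \<and>
              continuous_map (src f) (tgt f) (fn f) \<and> fn f \<in> extensional (topspace (src f))},
    Dom = src,
    Cod = tgt,
    Id = (\<lambda>X. Top_Mor X (\<lambda>x\<in>topspace X. x) X),
    Comp = (\<lambda>g f. Top_Mor (src f) (compose (topspace (src f)) (fn g) (fn f)) (tgt g))\<rparr>"

lemma category_Top: "category Top"
  unfolding category_def
proof (intro conjI ballI impI)
  fix f g h :: "'u top_mor"
  assume f: "f \<in> Mor Top" and "g \<in> Mor Top" "h \<in> Mor Top"
    and "Cod Top f = Dom Top g \<and> Cod Top g = Dom Top h"
  then show "Comp Top h (Comp Top g f) = Comp Top (Comp Top h g) f"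
    by (auto simp: Top_def fun_eq_iff compose_def continuous_map_def)
next
  fix f :: "'u top_mor"
  assume "f \<in> Mor Top"
  then show "Comp Top f (Id Top (Dom Top f)) = f" "Comp Top (Id Top (Cod Top f)) f = f"
    by (cases f; auto simp: Top_def fun_eq_iff compose_def continuous_map_def extensional_def)+
next
  fix f g :: "'u top_mor"
  assume "f \<in> Mor Top" "g \<in> Mor Top" "Cod Top f = Dom Top g"
  moreover from this
  have "continuous_map (src f) (tgt g) (compose (topspace (src f)) (fn g) (fn f))"
    by (auto simp: Top_def compose_def
        intro: continuous_map_eq[OF continuous_map_compose[of "src f" "tgt f" "fn f" "tgt g" "fn g"]])
  ultimately show "Comp Top g f \<in> Mor Top"
    by (simp add: Top_def)
next
  fix X :: "'u topology"
  assume "X \<in> Obj Top"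
  moreover have "continuous_map X X (\<lambda>x\<in>topspace X. x)"
    by (rule continuous_map_eq[OF continuous_map_id]) simp
  ultimately show "Id Top X \<in> Mor Top"
    by (simp add: Top_def)
qed (simp_all add: Top_def)

text \<open>A quotient map is universal if its pullback along every continuous map from a space in
  \<^term>\<open>Top\<close> is a quotient map.  The type of points of the domain is kept arbitrary so that
  the notion applies to maps out of a coproduct \<^term>\<open>sum_topology\<close>.\<close>

definition fibre_product ::
  "'b topology \<Rightarrow> ('b \<Rightarrow> 'c) \<Rightarrow> 'a topology \<Rightarrow> ('a \<Rightarrow> 'c) \<Rightarrow> ('b \<times> 'a) topology" where
  "fibre_product Y g A q = subtopology (prod_topology Y A) {(y, a). g y = q a}"

definition universal_quotient_map ::
  "'a topology \<Rightarrow> 'u topology \<Rightarrow> ('a \<Rightarrow> 'u) \<Rightarrow> bool" where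
  "universal_quotient_map A X q \<longleftrightarrow> quotient_map A X q \<and>
    (\<forall>(Y :: 'u topology) g. small (topspace Y) \<and> continuous_map Y X g \<longrightarrow>
        quotient_map (fibre_product Y g A q) Y fst)"

definition coprod_space :: "('i, 'u top_mor) family \<Rightarrow> ('i \<times> 'u) topology" where
  "coprod_space F = sum_topology (\<lambda>i. src (snd F i)) (fst F)"

definition coprod_map :: "('i, 'u top_mor) family \<Rightarrow> 'i \<times> 'u \<Rightarrow> 'u" where
  "coprod_map F = (\<lambda>(i, a). fn (snd F i) a)"

text \<open>Families are indexed by small sets, which up to bijection are small subsets of \<open>'u\<close>.\<close>

definition K_Top :: "'u topology \<Rightarrow> ('u, 'u top_mor) family set" where
  "K_Top X = {F. small (fst F) \<and> family_on Top X F \<and>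
                 universal_quotient_map (coprod_space F) X (coprod_map F)}"

end

theory Submission
  imports Defs
begin

text \<open>
  A sieve on \<open>X\<close> is a colim sieve iff its members cover \<open>X\<close> and \<open>X\<close> carries the final topology
  for them: the points of the colimit are the points of \<open>X\<close> that are reached, because every
  reached point is itself a member with one-point source, and the topology of a colimit
  is the final one.  For the members of a family this condition says that the coproduct
  maps onto \<open>X\<close> by a quotient map, and neither generating a sieve nor passing from a sieve to
  a suitable small subset changes it: to detect all failures of openness, one member for each set
  of points suffices, and there is only a small set of those.  Since pulling back commutes with
  generating sieves and with coproducts, the map induced by a family is a universal quotient map
  iff the family generates a universal colim sieve
  (\<open>coprod_universal_quotient_map_iff\<close>).

  The remaining difficulty is to find a small universal family inside a universal colim sieve
  \<open>S\<close>: for each space \<open>Y\<close> over \<open>X\<close> some small part of \<open>S\<close> is good enough, but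
  there is a proper class of such \<open>Y\<close>.  The key is
  \<open>universal_colim_sieve_by_refinements\<close>: it suffices to test with the refinements of
  the topology of \<open>X\<close> on the same points.  These form a small set, so that one member
  of \<open>S\<close> for each refinement and each point of \<open>X\<close> will do.

  Consequently the topology generated by the universal quotient families consists of all universal
  colim sieves.  These form a Grothendieck topology, since finality is transitive; it is
  subcanonical, since a matching family for a representable presheaf is a cocone under
  the sieve; and it contains every other subcanonical topology, since such a topology is closed
  under pullback and consists of colim sieves.  The axioms of a basis are the corresponding
  properties of the generated sieves.
\<close>

section \<open>Sieves in a category\<close>

context
  fixes C :: "('o, 'm) cat"
  assumes C: "category C"
begin

lemma Dom_Obj: "f \<in> Mor C \<Longrightarrow> Dom C f \<in> Obj C"
  and Id_hom: "X \<in> Obj C \<Longrightarrow> Id C X \<in> hom C X X"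
  and Comp_Id: "f \<in> Mor C \<Longrightarrow> Comp C f (Id C (Dom C f)) = f"
  and Id_Comp: "f \<in> Mor C \<Longrightarrow> Comp C (Id C (Cod C f)) f = f"
  using C unfolding category_def hom_def by auto

lemma Comp_Mor:
  assumes "f \<in> Mor C" "g \<in> Mor C" "Cod C f = Dom C g"
  shows "Comp C g f \<in> Mor C" "Dom C (Comp C g f) = Dom C f" "Cod C (Comp C g f) = Cod C g"
  using C assms unfolding category_def by auto

lemma Comp_assoc:
  assumes "f \<in> Mor C" "g \<in> Mor C" "h \<in> Mor C" "Cod C f = Dom C g" "Cod C g = Dom C h"
  shows "Comp C h (Comp C g f) = Comp C (Comp C h g) f"
  using C assms unfolding category_def by blast

lemma sieve_pullback:
  assumes "sieve C X S" "g \<in> Mor C" "Cod C g = X"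
  shows "sieve C (Dom C g) (pullback_sieve C g S)"
  using assms unfolding sieve_def pullback_sieve_def
  by (auto simp: Dom_Obj Comp_Mor Comp_assoc)

lemma pullback_pullback_sieve:
  assumes "f \<in> Mor C" "g \<in> Mor C" "Cod C g = Dom C f"
  shows "pullback_sieve C g (pullback_sieve C f S) = pullback_sieve C (Comp C f g) S"
  using assms unfolding pullback_sieve_def by (auto simp: Comp_Mor Comp_assoc)

lemma pullback_sieve_Id:
  assumes "sieve C X S"
  shows "pullback_sieve C (Id C X) S = S"
  using assms Id_hom[of X] Id_Comp unfolding sieve_def pullback_sieve_def hom_def by auto

lemma sieve_maximal: "X \<in> Obj C \<Longrightarrow> sieve C X {f \<in> Mor C. Cod C f = X}"
  unfolding sieve_def by (auto simp: Comp_Mor)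

lemma sieve_generated:
  assumes "X \<in> Obj C" "\<forall>f\<in>R. f \<in> Mor C \<and> Cod C f = X"
  shows "sieve C X (generated_sieve C R)"
  unfolding sieve_def generated_sieve_def
proof (intro conjI ballI impI)
  fix f g assume "f \<in> {h. \<exists>f\<in>R. \<exists>g\<in>Mor C. Cod C g = Dom C f \<and> h = Comp C f g}"
    and g: "g \<in> Mor C" "Cod C g = Dom C f"
  then obtain r k where rk: "r \<in> R" "k \<in> Mor C" "Cod C k = Dom C r" "f = Comp C r k"
    by auto
  then have "r \<in> Mor C" using assms by auto
  then have "Comp C f g = Comp C r (Comp C k g)" "Comp C k g \<in> Mor C" "Cod C (Comp C k g) = Dom C r"
    using rk g by (auto simp: Comp_Mor Comp_assoc)
  then show "Comp C f g \<in> {h. \<exists>f\<in>R. \<exists>g\<in>Mor C. Cod C g = Dom C f \<and> h = Comp C f g}"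
    using rk by blast
qed (use assms in \<open>auto simp: Comp_Mor\<close>)

lemma generated_sieve_superset:
  assumes "\<forall>f\<in>R. f \<in> Mor C"
  shows "R \<subseteq> generated_sieve C R"
proof
  fix f assume f: "f \<in> R"
  then have "f = Comp C f (Id C (Dom C f))" "Id C (Dom C f) \<in> hom C (Dom C f) (Dom C f)"
    using assms Comp_Id Id_hom Dom_Obj by auto
  then show "f \<in> generated_sieve C R"
    using f unfolding generated_sieve_def hom_def by blast
qed

lemma generated_sieve_least:
  assumes "sieve C X S" "R \<subseteq> S"
  shows "generated_sieve C R \<subseteq> S"
  using assms unfolding sieve_def generated_sieve_def by blast

text \<open>A morphism into the source of \<open>g\<close> becomes a factorisation through \<open>f i\<close> after composition
  with \<open>g\<close> exactly if it factors through the pullback of \<open>f i\<close>.\<close>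

lemma pullback_generated_sieve:
  assumes pb: "\<forall>i\<in>I. is_pullback C (f i) g (p i) (q i)" and g: "g \<in> Mor C"
  shows "pullback_sieve C g (generated_sieve C (f ` I)) = generated_sieve C (q ` I)"
proof (intro set_eqI iffI)
  fix h assume "h \<in> pullback_sieve C g (generated_sieve C (f ` I))"
  then obtain i k where h: "h \<in> Mor C" "Cod C h = Dom C g" and i: "i \<in> I"
    and k: "k \<in> Mor C" "Cod C k = Dom C (f i)" "Comp C g h = Comp C (f i) k"
    unfolding pullback_sieve_def generated_sieve_def by auto
  have pbi: "is_pullback C (f i) g (p i) (q i)" using pb i by blast
  then have "Dom C h = Dom C k"
    using h k g Comp_Mor unfolding is_pullback_def by metis
  then obtain u where "u \<in> hom C (Dom C k) (Dom C (p i))" "Comp C (q i) u = h"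
    using pbi h k unfolding is_pullback_def by metis
  moreover have "Dom C (p i) = Dom C (q i)" using pbi unfolding is_pullback_def by blast
  ultimately show "h \<in> generated_sieve C (q ` I)"
    using i unfolding generated_sieve_def hom_def by auto
next
  fix h assume "h \<in> generated_sieve C (q ` I)"
  then obtain i k where i: "i \<in> I" and k: "k \<in> Mor C" "Cod C k = Dom C (q i)" "h = Comp C (q i) k"
    unfolding generated_sieve_def by auto
  have pbi: "is_pullback C (f i) g (p i) (q i)" using pb i by blast
  then have m: "f i \<in> Mor C" "p i \<in> Mor C" "q i \<in> Mor C" "Dom C (p i) = Dom C (q i)"
    "Cod C (p i) = Dom C (f i)" "Cod C (q i) = Dom C g" "Comp C (f i) (p i) = Comp C g (q i)"
    unfolding is_pullback_def by auto
  have "Comp C g h = Comp C (f i) (Comp C (p i) k)"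
    using m k g by (simp add: Comp_assoc)
  moreover have "Comp C (p i) k \<in> Mor C" "Cod C (Comp C (p i) k) = Dom C (f i)"
    "h \<in> Mor C" "Cod C h = Dom C g"
    using m k by (auto simp: Comp_Mor)
  ultimately show "h \<in> pullback_sieve C g (generated_sieve C (f ` I))"
    using i unfolding pullback_sieve_def generated_sieve_def by auto
qed

lemma sieve_cocone_iff_matching_family:
  assumes S: "sieve C X S" and Z: "Z \<in> Obj C"
  shows "sieve_cocone C S Z \<phi> \<longleftrightarrow> matching_family C (representable_presheaf C Z) S \<phi>"
proof
  assume co: "sieve_cocone C S Z \<phi>"
  have "\<phi> (Comp C f g) = Comp C (\<phi> f) g" if "f \<in> S" "g \<in> Mor C" "Cod C g = Dom C f" for f g
  proof -
    have "Comp C f g \<in> S" "g \<in> hom C (Dom C (Comp C f g)) (Dom C f)"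
      using S that by (auto simp: sieve_def hom_def Comp_Mor)
    then show ?thesis using co that unfolding sieve_cocone_def by metis
  qed
  then show "matching_family C (representable_presheaf C Z) S \<phi>"
    using co unfolding sieve_cocone_def matching_family_def representable_presheaf_def by auto
next
  assume "matching_family C (representable_presheaf C Z) S \<phi>"
  then show "sieve_cocone C S Z \<phi>"
    using Z unfolding sieve_cocone_def matching_family_def representable_presheaf_def hom_def
    by auto
qed

lemma sieve_cocone_self:
  assumes "sieve C X S"
  shows "sieve_cocone C S X (\<lambda>f. f)"
  using assms unfolding sieve_cocone_def sieve_def hom_def by auto

text \<open>An isomorphism \<open>c\<close> from some colimit transports the universal property to \<open>X\<close>
  itself: \<open>u\<close> is a factorisation through \<open>X\<close> iff \<open>u \<circ> c\<close> is one through the colimit.\<close>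

lemma colim_sieve_iff_sieve_colimit:
  assumes S: "sieve C X S"
  shows "colim_sieve C X S \<longleftrightarrow> sieve_colimit C S X (\<lambda>f. f)"
proof
  assume "sieve_colimit C S X (\<lambda>f. f)"
  moreover have X: "X \<in> Obj C" using S unfolding sieve_def by blast
  have "iso_mor C (Id C X)" "\<forall>f\<in>S. Comp C (Id C X) f = f" "Id C X \<in> hom C X X"
    using S X Id_hom[OF X] Comp_Id[of "Id C X"] Id_Comp unfolding iso_mor_def hom_def sieve_def
    by auto
  ultimately show "colim_sieve C X S" unfolding colim_sieve_def by blast
next
  assume "colim_sieve C X S"
  then obtain L \<iota> c where L: "sieve_colimit C S L \<iota>" and c: "c \<in> hom C L X"
    and c\<iota>: "\<forall>f\<in>S. Comp C c (\<iota> f) = f" and "iso_mor C c"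
    unfolding colim_sieve_def by blast
  then obtain d where d: "d \<in> hom C X L" "Comp C d c = Id C L" "Comp C c d = Id C X"
    unfolding iso_mor_def hom_def by auto
  have \<iota>: "\<iota> f \<in> Mor C" "Dom C (\<iota> f) = Dom C f" "Cod C (\<iota> f) = L" if "f \<in> S" for f
    using L that unfolding sieve_colimit_def sieve_cocone_def hom_def by auto
  have fS: "f \<in> Mor C" "Cod C f = X" if "f \<in> S" for f
    using S that unfolding sieve_def by auto
  have c': "c \<in> Mor C" "Dom C c = L" "Cod C c = X" and d': "d \<in> Mor C" "Dom C d = X" "Cod C d = L"
    using c d unfolding hom_def by auto
  have df: "Comp C d f = \<iota> f" if "f \<in> S" for f
  proof -
    have "Comp C d f = Comp C (Comp C d c) (\<iota> f)"
      using c\<iota> that \<iota>[OF that] c' d' by (metis Comp_assoc)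
    then show ?thesis using \<iota>[OF that] d(2) Id_Comp by metis
  qed
  show "sieve_colimit C S X (\<lambda>f. f)"
    unfolding sieve_colimit_def
  proof (intro conjI allI impI sieve_cocone_self[OF S])
    fix Z \<phi> assume \<phi>: "sieve_cocone C S Z \<phi>"
    then obtain u where u: "u \<in> hom C L Z" "\<forall>f\<in>S. Comp C u (\<iota> f) = \<phi> f"
      and uniq: "\<And>v. v \<in> hom C L Z \<Longrightarrow> \<forall>f\<in>S. Comp C v (\<iota> f) = \<phi> f \<Longrightarrow> v = u"
      using L unfolding sieve_colimit_def by metis
    have u': "u \<in> Mor C" "Dom C u = L" "Cod C u = Z" using u unfolding hom_def by auto
    show "\<exists>!w. w \<in> hom C X Z \<and> (\<forall>f\<in>S. Comp C w f = \<phi> f)"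
    proof (rule ex1I[of _ "Comp C u d"], intro conjI ballI)
      show "Comp C u d \<in> hom C X Z" using u' d' Comp_Mor unfolding hom_def by auto
      show "Comp C (Comp C u d) f = \<phi> f" if "f \<in> S" for f
        using Comp_assoc[of f d u] fS[OF that] u' d' df[OF that] u that by auto
      fix w assume w: "w \<in> hom C X Z \<and> (\<forall>f\<in>S. Comp C w f = \<phi> f)"
      then have w': "w \<in> Mor C" "Dom C w = X" "Cod C w = Z" unfolding hom_def by auto
      have "Comp C (Comp C w c) (\<iota> f) = \<phi> f" if "f \<in> S" for f
        using Comp_assoc[of "\<iota> f" c w] c\<iota> w w' c' \<iota>[OF that] that by auto
      moreover have "Comp C w c \<in> hom C L Z" using w' c' Comp_Mor unfolding hom_def by auto
      ultimately have "Comp C w c = u" using uniq by blast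
      then have "Comp C u d = Comp C w (Comp C c d)"
        using Comp_assoc[of d c w] w' c' d' by auto
      then show "w = Comp C u d" using d(3) Comp_Id[of w] w' by auto
    qed
  qed
qed

text \<open>A matching family for the presheaf represented by \<open>Z\<close> is a cocone with vertex \<open>Z\<close>, so the
  sheaf condition at \<open>S\<close> for all representables says that \<open>X\<close> is the colimit of \<open>S\<close>.\<close>

lemma colim_sieve_iff_representable:
  assumes S: "sieve C X S"
  shows "colim_sieve C X S \<longleftrightarrow>
    (\<forall>Z\<in>Obj C. \<forall>\<phi>. matching_family C (representable_presheaf C Z) S \<phi> \<longrightarrow>
      (\<exists>!u. u \<in> hom C X Z \<and> (\<forall>f\<in>S. Comp C u f = \<phi> f)))"
proof -
  have "sieve_cocone C S Z \<phi> \<longleftrightarrow>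
      Z \<in> Obj C \<and> matching_family C (representable_presheaf C Z) S \<phi>" for Z \<phi>
    using sieve_cocone_iff_matching_family[OF S] unfolding sieve_cocone_def by blast
  then show ?thesis
    using sieve_cocone_self[OF S]
    by (simp add: colim_sieve_iff_sieve_colimit[OF S] sieve_colimit_def Ball_def imp_conjL)
qed

lemma subcanonical_iff_colim_sieve:
  assumes "\<forall>X\<in>Obj C. \<forall>S\<in>J X. sieve C X S"
  shows "subcanonical C J \<longleftrightarrow> (\<forall>X\<in>Obj C. \<forall>S\<in>J X. colim_sieve C X S)"
proof -
  have PObj: "PObj (representable_presheaf C Z) X = hom C X Z"
    and PMor: "PMor (representable_presheaf C Z) g x = Comp C x g" for X Z g x
    by (simp_all add: representable_presheaf_def)
  have swap: "(\<forall>Z\<in>Obj C. \<forall>X\<in>Obj C. \<forall>S\<in>J X. P Z X S) \<longleftrightarrow> (\<forall>X\<in>Obj C. \<forall>S\<in>J X. \<forall>Z\<in>Obj C. P Z X S)"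
    for P by blast
  have "subcanonical C J \<longleftrightarrow>
    (\<forall>X\<in>Obj C. \<forall>S\<in>J X. \<forall>Z\<in>Obj C. \<forall>\<phi>. matching_family C (representable_presheaf C Z) S \<phi> \<longrightarrow>
      (\<exists>!u. u \<in> hom C X Z \<and> (\<forall>f\<in>S. Comp C u f = \<phi> f)))"
    unfolding subcanonical_def is_sheaf_def by (simp only: PObj PMor swap)
  also have "\<dots> \<longleftrightarrow> (\<forall>X\<in>Obj C. \<forall>S\<in>J X. colim_sieve C X S)"
    using assms by (simp add: colim_sieve_iff_representable)
  finally show ?thesis .
qed

lemma universal_colim_sieve_pullback:
  assumes "universal_colim_sieve C X S" "g \<in> Mor C" "Cod C g = X"
  shows "universal_colim_sieve C (Dom C g) (pullback_sieve C g S)"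
  unfolding universal_colim_sieve_def
proof (intro ballI impI)
  fix \<alpha> assume "\<alpha> \<in> Mor C" "Cod C \<alpha> = Dom C g"
  then have "colim_sieve C (Dom C (Comp C g \<alpha>)) (pullback_sieve C (Comp C g \<alpha>) S)"
    using assms Comp_Mor[of \<alpha> g] unfolding universal_colim_sieve_def by blast
  then show "colim_sieve C (Dom C \<alpha>) (pullback_sieve C \<alpha> (pullback_sieve C g S))"
    using \<open>\<alpha> \<in> Mor C\<close> \<open>Cod C \<alpha> = Dom C g\<close> assms(2)
    by (simp add: pullback_pullback_sieve Comp_Mor)
qed

lemma universal_colim_sieve_imp_colim_sieve:
  assumes "universal_colim_sieve C X S" "sieve C X S"
  shows "colim_sieve C X S"
proof -
  have "Id C X \<in> Mor C" "Dom C (Id C X) = X" "Cod C (Id C X) = X"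
    using assms(2) Id_hom unfolding sieve_def hom_def by auto
  then have "colim_sieve C X (pullback_sieve C (Id C X) S)"
    using assms(1) unfolding universal_colim_sieve_def by force
  then show ?thesis by (simp add: pullback_sieve_Id[OF assms(2)])
qed

lemma subcanonical_imp_universal_colim_sieve:
  assumes J: "grothendieck_topology C J" "subcanonical C J" and S: "X \<in> Obj C" "S \<in> J X"
  shows "universal_colim_sieve C X S"
proof -
  have "\<forall>X\<in>Obj C. \<forall>S\<in>J X. sieve C X S" using J(1) unfolding grothendieck_topology_def by blast
  then have "\<forall>X\<in>Obj C. \<forall>S\<in>J X. colim_sieve C X S"
    using J(2) subcanonical_iff_colim_sieve by blast
  moreover have "pullback_sieve C g S \<in> J (Dom C g)" if "g \<in> Mor C" "Cod C g = X" for g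
    using J(1) S that unfolding grothendieck_topology_def by blast
  ultimately show ?thesis
    unfolding universal_colim_sieve_def by (simp add: Dom_Obj)
qed

end

section \<open>Small sets\<close>

text \<open>Smallness of a set of arbitrary type means \<open>A \<prec> (UNIV :: 'u set)\<close> throughout; for
  \<open>A :: 'u set\<close> this is \<^const>\<open>small\<close>.\<close>

context
  assumes U: "universe TYPE('u)"
begin

lemma infinite_points: "infinite (UNIV :: 'u set)"
  using U unfolding universe_def by blast

lemma small_finite: "finite A \<Longrightarrow> small (A :: 'u set)"
  unfolding small_def by (rule finite_lesspoll_infinite[OF infinite_points])

lemma small_subset: "small B \<Longrightarrow> A \<subseteq> B \<Longrightarrow> small (A :: 'u set)"
  unfolding small_def by (meson lesspoll_trans1 subset_imp_lepoll)

lemma small_UN: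
  fixes I :: "'u set" and A :: "'u \<Rightarrow> 'u set"
  assumes "small I" "\<And>i. i \<in> I \<Longrightarrow> small (A i)"
  shows "small (\<Union>i\<in>I. A i)"
proof -
  have "\<forall>(I :: 'u set) (A :: 'u \<Rightarrow> 'u set).
      small I \<and> (\<forall>i\<in>I. small (A i)) \<longrightarrow> small (\<Union>i\<in>I. A i)"
    using U unfolding universe_def by (elim conjE)
  from this[rule_format, of I A] assms show ?thesis by blast
qed

lemma lesspoll_embedding:
  assumes "(A :: 'a set) \<prec> (UNIV :: 'u set)"
  obtains e :: "'a \<Rightarrow> 'u" where "inj_on e A" "small (e ` A)"
proof -
  obtain e :: "'a \<Rightarrow> 'u" where e: "inj_on e A"
    using assms unfolding lesspoll_def lepoll_def by blast
  then show thesis using that assms unfolding small_def by simp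
qed

lemma Pow_lesspoll_points:
  assumes "(A :: 'a set) \<prec> (UNIV :: 'u set)"
  shows "Pow A \<prec> (UNIV :: 'u set)"
proof -
  obtain e :: "'a \<Rightarrow> 'u" where e: "inj_on e A" "small (e ` A)"
    using lesspoll_embedding[OF assms] .
  have "inj_on ((`) e) (Pow A)" using e(1) by (rule inj_on_image_Pow)
  moreover have "(`) e ` Pow A \<prec> (UNIV :: 'u set)"
    using U e(2) unfolding universe_def image_Pow_surj[OF refl] by blast
  ultimately show ?thesis by simp
qed

lemma pairing_of_points:
  obtains p :: "'u \<times> 'u \<Rightarrow> 'u" where "inj p"
  using infinite_points card_of_Times_same_infinite[of "UNIV :: 'u set"]
  unfolding UNIV_Times_UNIV by (metis bij_betw_def card_of_ordIso)

text \<open>Regularity speaks of unions of sets of points only; a pairing function on the points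
  turns disjoint unions into such unions.\<close>

lemma Sigma_lesspoll_points:
  assumes A: "(A :: 'a set) \<prec> (UNIV :: 'u set)"
    and B: "\<And>a. a \<in> A \<Longrightarrow> (B a :: 'b set) \<prec> (UNIV :: 'u set)"
  shows "Sigma A B \<prec> (UNIV :: 'u set)"
proof -
  obtain e :: "'a \<Rightarrow> 'u" where e: "inj_on e A" "small (e ` A)"
    using lesspoll_embedding[OF A] .
  have "\<forall>a\<in>A. \<exists>d :: 'b \<Rightarrow> 'u. inj_on d (B a) \<and> small (d ` B a)"
    using lesspoll_embedding[OF B] by metis
  then obtain d :: "'a \<Rightarrow> 'b \<Rightarrow> 'u"
    where d: "\<And>a. a \<in> A \<Longrightarrow> inj_on (d a) (B a)" "\<And>a. a \<in> A \<Longrightarrow> small (d a ` B a)"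
    by metis
  obtain p :: "'u \<times> 'u \<Rightarrow> 'u" where p: "inj p" using pairing_of_points .
  let ?f = "\<lambda>(a, b). p (e a, d a b)"
  have inj: "inj_on ?f (Sigma A B)"
  proof (rule inj_onI)
    fix x y assume xy: "x \<in> Sigma A B" "y \<in> Sigma A B" "?f x = ?f y"
    obtain a b a' b' where ab: "x = (a, b)" "y = (a', b')" by (cases x, cases y) blast
    then have "e a = e a'" "d a b = d a' b'" using xy(3) injD[OF p] by auto
    then show "x = y"
      using ab xy inj_onD[OF e(1), of a a'] inj_onD[OF d(1), of a b b'] by auto
  qed
  have "small (\<Union>i\<in>e ` A. (\<lambda>c. p (i, c)) ` d (inv_into A e i) ` B (inv_into A e i))"
  proof -
    have "small ((\<lambda>c. p (i, c)) ` D)" if "small D" for i D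
    proof -
      have "inj_on (\<lambda>c. p (i, c)) D" by (rule inj_onI) (use injD[OF p] in blast)
      then show ?thesis using that unfolding small_def by simp
    qed
    then have "small ((\<lambda>c. p (i, c)) ` d (inv_into A e i) ` B (inv_into A e i))"
      if "i \<in> e ` A" for i
      using d(2)[OF inv_into_into[OF that]] by simp
    then show ?thesis using e(2) by (intro small_UN)
  qed
  moreover have "?f ` Sigma A B \<subseteq>
      (\<Union>i\<in>e ` A. (\<lambda>c. p (i, c)) ` d (inv_into A e i) ` B (inv_into A e i))"
    using e(1) by (auto simp: inv_into_f_f)
  ultimately have "small (?f ` Sigma A B)" using small_subset by blast
  then show ?thesis using inj unfolding small_def by simp
qed

lemma homeomorphic_copy_on_points:
  fixes T :: "'a topology"
  assumes "topspace T \<prec> (UNIV :: 'u set)"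
  obtains T' :: "'u topology" and e d where "small (topspace T')" "homeomorphic_maps T T' e d"
proof -
  obtain e :: "'a \<Rightarrow> 'u" where e: "inj_on e (topspace T)" "small (e ` topspace T)"
    using lesspoll_embedding[OF assms] .
  let ?d = "inv_into (topspace T) e"
  define T' where "T' = pullback_topology (e ` topspace T) ?d T"
  have de: "?d (e x) = x" if "x \<in> topspace T" for x using e(1) that by simp
  have sp: "topspace T' = e ` topspace T"
    unfolding T'_def topspace_pullback_topology using de by auto
  have "continuous_map T T' e"
    unfolding T'_def using de
    by (intro continuous_map_pullback') (auto intro: continuous_map_eq[OF continuous_map_id])
  moreover have "continuous_map T' T ?d"
    using continuous_map_pullback[OF continuous_map_id, where A = "e ` topspace T" and f = ?d]
    unfolding T'_def by (simp add: id_def o_def)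
  ultimately have "homeomorphic_maps T T' e ?d"
    unfolding homeomorphic_maps_def using de sp by auto
  then show thesis by (rule that[rotated]) (simp add: sp e(2))
qed

end

section \<open>Morphisms and pullbacks of spaces\<close>

lemma Top_simps [simp]:
  "X \<in> Obj Top \<longleftrightarrow> small (topspace X)" "Dom Top = src" "Cod Top = tgt"
  "src (Comp Top g f) = src f" "tgt (Comp Top g f) = tgt g"
  "x \<in> topspace (src f) \<Longrightarrow> fn (Comp Top g f) x = fn g (fn f x)"
  by (simp_all add: Top_def compose_eq)

lemma Mor_Top_iff:
  "f \<in> Mor Top \<longleftrightarrow> small (topspace (src f)) \<and> small (topspace (tgt f)) \<and>
     continuous_map (src f) (tgt f) (fn f) \<and> fn f \<in> extensional (topspace (src f))"
  by (simp add: Top_def)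

lemma Mor_TopD:
  assumes "f \<in> Mor Top"
  shows "small (topspace (src f))" "small (topspace (tgt f))"
    "continuous_map (src f) (tgt f) (fn f)"
  using assms by (auto simp: Mor_Top_iff)

lemma Mor_Top_point: "f \<in> Mor Top \<Longrightarrow> a \<in> topspace (src f) \<Longrightarrow> fn f a \<in> topspace (tgt f)"
  using Mor_TopD(3) continuous_map_image_subset_topspace by blast

definition top_arrow :: "'u topology \<Rightarrow> 'u topology \<Rightarrow> ('u \<Rightarrow> 'u) \<Rightarrow> 'u top_mor" where
  "top_arrow X Y f = Top_Mor X (restrict f (topspace X)) Y"

lemma top_arrow_simps [simp]:
  "src (top_arrow X Y f) = X" "tgt (top_arrow X Y f) = Y"
  "x \<in> topspace X \<Longrightarrow> fn (top_arrow X Y f) x = f x"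
  by (simp_all add: top_arrow_def)

lemma top_arrow_Mor:
  assumes "small (topspace X)" "small (topspace Y)" "continuous_map X Y f"
  shows "top_arrow X Y f \<in> Mor Top"
  using assms by (auto simp: Mor_Top_iff top_arrow_def intro: continuous_map_eq)

lemma top_mor_eqI:
  assumes "f \<in> Mor Top" "g \<in> Mor Top" "src f = src g" "tgt f = tgt g"
    "\<And>x. x \<in> topspace (src f) \<Longrightarrow> fn f x = fn g x"
  shows "f = g"
  using assms extensionalityI[of "fn f" "topspace (src f)" "fn g"]
  by (intro top_mor.expand) (auto simp: Mor_Top_iff)

lemma Comp_Top_eqI:
  assumes "f \<in> Mor Top" "g \<in> Mor Top" "h \<in> Mor Top" "tgt f = src g"
    "src h = src f" "tgt h = tgt g" "\<And>x. x \<in> topspace (src f) \<Longrightarrow> fn g (fn f x) = fn h x"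
  shows "Comp Top g f = h"
proof (rule top_mor_eqI)
  show "Comp Top g f \<in> Mor Top" using Comp_Mor(1)[OF category_Top, of f g] assms by simp
qed (use assms in auto)

lemma Comp_Top_Mor: "f \<in> Mor Top \<Longrightarrow> g \<in> Mor Top \<Longrightarrow> tgt f = src g \<Longrightarrow> Comp Top g f \<in> Mor Top"
  using Comp_Mor(1)[OF category_Top, of f g] by simp

lemma fn_cong_Comp:
  assumes "Comp Top f p = Comp Top g q" "x \<in> topspace (src p)"
  shows "fn f (fn p x) = fn g (fn q x)"
proof -
  have "src p = src q" using assms(1) by (metis Top_simps(4))
  then show ?thesis using assms by (metis Top_simps(6))
qed

lemma topspace_fibre_product:
  "topspace (fibre_product Y g A q) = {(y, a). y \<in> topspace Y \<and> a \<in> topspace A \<and> g y = q a}"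
  unfolding fibre_product_def by auto

lemma continuous_map_fibre_product_fst: "continuous_map (fibre_product Y g A q) Y fst"
  and continuous_map_fibre_product_snd: "continuous_map (fibre_product Y g A q) A snd"
  unfolding fibre_product_def
  by (intro continuous_map_from_subtopology continuous_map_fst continuous_map_snd)+

lemma continuous_map_into_fibre_product:
  assumes "continuous_map Z Y h" "continuous_map Z A k" "\<And>z. z \<in> topspace Z \<Longrightarrow> g (h z) = q (k z)"
  shows "continuous_map Z (fibre_product Y g A q) (\<lambda>z. (h z, k z))"
  using assms unfolding fibre_product_def
  by (intro continuous_map_into_subtopology continuous_map_pairedI) auto

lemma openin_fibre_product:
  "openin (fibre_product Y g A q) W \<longleftrightarrow> W \<subseteq> topspace (fibre_product Y g A q) \<and>
    (\<forall>(y, a)\<in>W. \<exists>N V. openin Y N \<and> openin A V \<and> y \<in> N \<and> a \<in> V \<and>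
       (\<forall>y'\<in>N. \<forall>a'\<in>V. g y' = q a' \<longrightarrow> (y', a') \<in> W))"
proof
  assume W: "openin (fibre_product Y g A q) W"
  then obtain W' where W': "openin (prod_topology Y A) W'" "W = W' \<inter> {(y, a). g y = q a}"
    unfolding fibre_product_def openin_subtopology by blast
  then have "\<exists>N V. openin Y N \<and> openin A V \<and> y \<in> N \<and> a \<in> V \<and> N \<times> V \<subseteq> W'" if "(y, a) \<in> W" for y a
    using that unfolding openin_prod_topology_alt by blast
  then show "W \<subseteq> topspace (fibre_product Y g A q) \<and>
    (\<forall>(y, a)\<in>W. \<exists>N V. openin Y N \<and> openin A V \<and> y \<in> N \<and> a \<in> V \<and>
       (\<forall>y'\<in>N. \<forall>a'\<in>V. g y' = q a' \<longrightarrow> (y', a') \<in> W))"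
    using openin_subset[OF W] W'(2) by fast
next
  assume R: "W \<subseteq> topspace (fibre_product Y g A q) \<and>
    (\<forall>(y, a)\<in>W. \<exists>N V. openin Y N \<and> openin A V \<and> y \<in> N \<and> a \<in> V \<and>
       (\<forall>y'\<in>N. \<forall>a'\<in>V. g y' = q a' \<longrightarrow> (y', a') \<in> W))"
  show "openin (fibre_product Y g A q) W"
  proof (subst openin_subopen, intro ballI)
    fix w assume "w \<in> W"
    then obtain y a where w: "w = (y, a)" "(y, a) \<in> W" by (cases w) auto
    then obtain N V where NV: "openin Y N" "openin A V" "y \<in> N" "a \<in> V"
      "\<forall>y'\<in>N. \<forall>a'\<in>V. g y' = q a' \<longrightarrow> (y', a') \<in> W"
      using R by blast
    have "openin (fibre_product Y g A q) ((N \<times> V) \<inter> {(y, a). g y = q a})"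
      unfolding fibre_product_def openin_subtopology
      using NV by (intro exI[of _ "N \<times> V"]) (auto simp: openin_prod_Times_iff)
    moreover have "g y = q a" using R w(2) unfolding topspace_fibre_product by blast
    then have "w \<in> (N \<times> V) \<inter> {(y, a). g y = q a}" using NV(3,4) w(1) by simp
    moreover have "(N \<times> V) \<inter> {(y, a). g y = q a} \<subseteq> W" using NV(5) by auto
    ultimately show "\<exists>T. openin (fibre_product Y g A q) T \<and> w \<in> T \<and> T \<subseteq> W"
      by blast
  qed
qed

text \<open>The fibre product lives on pairs of points; a homeomorphic copy on points is a pullback
  in \<^const>\<open>Top\<close>.\<close>

lemma Top_pullback_exists:
  fixes f g :: "'u top_mor"
  assumes U: "universe TYPE('u)" and f: "f \<in> Mor Top" and g: "g \<in> Mor Top" and fg: "tgt f = tgt g"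
  obtains p q e where "is_pullback Top f g p q"
    "continuous_map (fibre_product (src g) (fn g) (src f) (fn f)) (src q) e"
    "\<And>y a. (y, a) \<in> topspace (fibre_product (src g) (fn g) (src f) (fn f)) \<Longrightarrow>
        fn q (e (y, a)) = y \<and> fn p (e (y, a)) = a"
proof -
  let ?P = "fibre_product (src g) (fn g) (src f) (fn f)"
  have "topspace (src g) \<times> topspace (src f) \<prec> (UNIV :: 'u set)"
    by (rule Sigma_lesspoll_points[OF U]) (use f g in \<open>auto simp: Mor_Top_iff small_def\<close>)
  moreover have "topspace ?P \<subseteq> topspace (src g) \<times> topspace (src f)"
    unfolding topspace_fibre_product by auto
  ultimately have "topspace ?P \<prec> (UNIV :: 'u set)"
    by (meson lesspoll_trans1 subset_imp_lepoll)
  then obtain P :: "'u topology" and e d where P: "small (topspace P)" "homeomorphic_maps ?P P e d"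
    using homeomorphic_copy_on_points[OF U] by blast
  then have e: "continuous_map ?P P e" and d: "continuous_map P ?P d"
    and de: "\<And>w. w \<in> topspace ?P \<Longrightarrow> d (e w) = w" and ed: "\<And>v. v \<in> topspace P \<Longrightarrow> e (d v) = v"
    unfolding homeomorphic_maps_def by auto
  have dP: "d v \<in> topspace ?P" if "v \<in> topspace P" for v
    using d that continuous_map_image_subset_topspace by blast
  have eP: "e w \<in> topspace P" if "w \<in> topspace ?P" for w
    using e that continuous_map_image_subset_topspace by blast
  define p where "p = top_arrow P (src f) (snd \<circ> d)"
  define q where "q = top_arrow P (src g) (fst \<circ> d)"
  have p: "p \<in> Mor Top" "src p = P" "tgt p = src f" "\<And>v. v \<in> topspace P \<Longrightarrow> fn p v = snd (d v)"
    using P(1) f continuous_map_compose[OF d continuous_map_fibre_product_snd]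
    unfolding p_def by (auto intro!: top_arrow_Mor dest: Mor_TopD)
  have q: "q \<in> Mor Top" "src q = P" "tgt q = src g" "\<And>v. v \<in> topspace P \<Longrightarrow> fn q v = fst (d v)"
    using P(1) g continuous_map_compose[OF d continuous_map_fibre_product_fst]
    unfolding q_def by (auto intro!: top_arrow_Mor dest: Mor_TopD)
  have comm: "Comp Top f p = Comp Top g q"
  proof (rule top_mor_eqI)
    show "Comp Top f p \<in> Mor Top" "Comp Top g q \<in> Mor Top"
      using Comp_Top_Mor[OF p(1) f p(3)] Comp_Top_Mor[OF q(1) g q(3)] .
    show "src (Comp Top f p) = src (Comp Top g q)" "tgt (Comp Top f p) = tgt (Comp Top g q)"
      using p(2) q(2) fg by simp_all
    fix v assume "v \<in> topspace (src (Comp Top f p))"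
    then have v: "v \<in> topspace P" using p by simp
    then have "fn g (fst (d v)) = fn f (snd (d v))"
      using dP[OF v] unfolding topspace_fibre_product by auto
    then show "fn (Comp Top f p) v = fn (Comp Top g q) v"
      using v p q by simp
  qed
  have "\<exists>!u. u \<in> hom Top (src a) (src p) \<and> Comp Top p u = a \<and> Comp Top q u = b"
    if a: "a \<in> Mor Top" and b: "b \<in> Mor Top" and ab: "src a = src b" "tgt a = src f" "tgt b = src g"
      and eq: "Comp Top f a = Comp Top g b" for a b
  proof -
    have pt: "(fn b z, fn a z) \<in> topspace ?P" if "z \<in> topspace (src a)" for z
      unfolding topspace_fibre_product
      using that ab Mor_Top_point[OF a that] Mor_Top_point[OF b, of z] fn_cong_Comp[OF eq that]
      by simp
    define u where "u = top_arrow (src a) P (\<lambda>z. e (fn b z, fn a z))"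
    have "continuous_map (src a) ?P (\<lambda>z. (fn b z, fn a z))"
    proof (rule continuous_map_into_fibre_product)
      show "continuous_map (src a) (src g) (fn b)" "continuous_map (src a) (src f) (fn a)"
        using Mor_TopD(3)[OF a] Mor_TopD(3)[OF b] ab by simp_all
      show "fn g (fn b z) = fn f (fn a z)" if "z \<in> topspace (src a)" for z
        using fn_cong_Comp[OF eq that] by simp
    qed
    then have "continuous_map (src a) P (\<lambda>z. e (fn b z, fn a z))"
      using continuous_map_compose[OF _ e] by (fastforce simp: o_def)
    then have u: "u \<in> Mor Top" "src u = src a" "tgt u = P"
      "\<And>z. z \<in> topspace (src a) \<Longrightarrow> fn u z = e (fn b z, fn a z)"
      using P(1) a unfolding u_def by (auto intro!: top_arrow_Mor dest: Mor_TopD)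
    show ?thesis
    proof (rule ex1I[of _ u], intro conjI)
      show "u \<in> hom Top (src a) (src p)" using u p by (simp add: hom_def)
      show "Comp Top p u = a" "Comp Top q u = b"
        by (rule Comp_Top_eqI; use u p q a b ab pt eP de in simp)+
      fix w assume w: "w \<in> hom Top (src a) (src p) \<and> Comp Top p w = a \<and> Comp Top q w = b"
      then have w': "w \<in> Mor Top" "src w = src a" "tgt w = P" using p by (auto simp: hom_def)
      show "w = u"
      proof (rule top_mor_eqI)
        fix z assume "z \<in> topspace (src w)"
        then have z: "z \<in> topspace (src a)" "fn w z \<in> topspace P"
          using w' Mor_Top_point[of w z] by auto
        have "fn p (fn w z) = fn a z" "fn q (fn w z) = fn b z"
          using Top_simps(6)[of z w p] Top_simps(6)[of z w q] w w' z by auto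
        then have "d (fn w z) = (fn b z, fn a z)" using p(4)[OF z(2)] q(4)[OF z(2)] by (metis prod.collapse)
        then have "fn w z = e (fn b z, fn a z)" using ed[OF z(2)] by simp
        then show "fn w z = fn u z" using u z by simp
      qed (use w' u in auto)
    qed
  qed
  then have "is_pullback Top f g p q"
    unfolding is_pullback_def using p q f g fg comm by simp
  moreover have "fn q (e (y, a)) = y \<and> fn p (e (y, a)) = a" if "(y, a) \<in> topspace ?P" for y a
    using p q de eP that by simp
  ultimately show thesis using that[of p q e] e q(2) by simp
qed

section \<open>Colim sieves are the jointly final ones\<close>

text \<open>Whether the coproduct of a family maps onto \<open>X\<close> by a quotient map depends on the set of
  members only, and the condition makes sense for sets of morphisms of any size, in particular
  for sieves: \<open>X\<close> is covered, and carries the final topology.\<close>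

definition final_cover :: "'u topology \<Rightarrow> 'u top_mor set \<Rightarrow> bool" where
  "final_cover X R \<longleftrightarrow>
    (\<forall>x\<in>topspace X. \<exists>r\<in>R. \<exists>a\<in>topspace (src r). fn r a = x) \<and>
    (\<forall>W\<subseteq>topspace X. (\<forall>r\<in>R. openin (src r) {a \<in> topspace (src r). fn r a \<in> W}) \<longrightarrow> openin X W)"

lemma final_coverD:
  assumes "final_cover X R"
  shows "x \<in> topspace X \<Longrightarrow> \<exists>r\<in>R. \<exists>a\<in>topspace (src r). fn r a = x"
    and "W \<subseteq> topspace X \<Longrightarrow> (\<And>r. r \<in> R \<Longrightarrow> openin (src r) {a \<in> topspace (src r). fn r a \<in> W}) \<Longrightarrow>
      openin X W"
  using assms unfolding final_cover_def by blast+

lemma final_cover_mono: "final_cover X R \<Longrightarrow> R \<subseteq> R' \<Longrightarrow> final_cover X R'"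
  unfolding final_cover_def by (meson subsetD)

lemma sieve_TopD:
  assumes "sieve Top X S" "f \<in> S"
  shows "f \<in> Mor Top" "tgt f = X"
  using assms unfolding sieve_def by auto

lemma sieve_Top_Comp:
  assumes "sieve Top X S" "f \<in> S" "g \<in> Mor Top" "tgt g = src f"
  shows "Comp Top f g \<in> S"
  using assms unfolding sieve_def by auto

lemma openin_preimage_Mor:
  "f \<in> Mor Top \<Longrightarrow> openin (tgt f) W \<Longrightarrow> openin (src f) {a \<in> topspace (src f). fn f a \<in> W}"
  using Mor_TopD(3) openin_continuous_map_preimage by blast

text \<open>A composite \<open>r \<circ> k\<close> reaches no further points than \<open>r\<close>, and preimages under it are open if
  those under \<open>r\<close> are.\<close>

lemma final_cover_generated_sieve:
  assumes R: "\<forall>r\<in>R. r \<in> Mor Top"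
  shows "final_cover X (generated_sieve Top R) \<longleftrightarrow> final_cover X R"
proof
  assume "final_cover X R"
  then show "final_cover X (generated_sieve Top R)"
    using final_cover_mono generated_sieve_superset[OF category_Top R] by blast
next
  assume fin: "final_cover X (generated_sieve Top R)"
  have gen: "\<exists>r\<in>R. \<exists>k\<in>Mor Top. tgt k = src r \<and> h = Comp Top r k"
    if "h \<in> generated_sieve Top R" for h
    using that unfolding generated_sieve_def by auto
  show "final_cover X R"
    unfolding final_cover_def
  proof (intro conjI ballI allI impI)
    fix x assume "x \<in> topspace X"
    then obtain h a where h: "h \<in> generated_sieve Top R" "a \<in> topspace (src h)" "fn h a = x"
      using final_coverD(1)[OF fin] by blast
    then obtain r k where "r \<in> R" and k: "k \<in> Mor Top" "tgt k = src r" "h = Comp Top r k"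
      using gen by blast
    moreover have "fn k a \<in> topspace (src r)" using Mor_Top_point[OF k(1), of a] h(2) k by simp
    moreover have "fn r (fn k a) = x" using h k by simp
    ultimately show "\<exists>r\<in>R. \<exists>a\<in>topspace (src r). fn r a = x" by blast
  next
    fix W assume W: "W \<subseteq> topspace X"
      "\<forall>r\<in>R. openin (src r) {a \<in> topspace (src r). fn r a \<in> W}"
    show "openin X W"
    proof (rule final_coverD(2)[OF fin W(1)])
      fix h assume "h \<in> generated_sieve Top R"
      then obtain r k where "r \<in> R" and k: "k \<in> Mor Top" "tgt k = src r" "h = Comp Top r k"
        using gen by blast
      then have "openin (src k) {a \<in> topspace (src k). fn k a \<in> {b \<in> topspace (src r). fn r b \<in> W}}"
        using openin_preimage_Mor[OF k(1), of "{b \<in> topspace (src r). fn r b \<in> W}"] W(2) by simp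
      moreover have "{a \<in> topspace (src k). fn k a \<in> {b \<in> topspace (src r). fn r b \<in> W}} =
          {a \<in> topspace (src h). fn h a \<in> W}"
        using k Mor_Top_point[OF k(1)] by auto
      ultimately show "openin (src h) {a \<in> topspace (src h). fn h a \<in> W}" using k by simp
    qed
  qed
qed

lemma final_cover_transitive:
  assumes S: "\<forall>f\<in>S. f \<in> Mor Top" "final_cover X S"
    and R: "\<And>f. f \<in> S \<Longrightarrow> final_cover (src f) (pullback_sieve Top f R)"
  shows "final_cover X R"
  unfolding final_cover_def
proof (intro conjI ballI allI impI)
  fix x assume "x \<in> topspace X"
  then obtain f a where f: "f \<in> S" "a \<in> topspace (src f)" "fn f a = x"
    using final_coverD(1)[OF S(2)] by blast
  then obtain h b where "h \<in> pullback_sieve Top f R" "b \<in> topspace (src h)" "fn h b = a"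
    using final_coverD(1)[OF R] by blast
  then show "\<exists>r\<in>R. \<exists>b\<in>topspace (src r). fn r b = x"
    using f unfolding pullback_sieve_def by (intro bexI[of _ "Comp Top f h"] bexI[of _ b]) auto
next
  fix W assume W: "W \<subseteq> topspace X" "\<forall>r\<in>R. openin (src r) {a \<in> topspace (src r). fn r a \<in> W}"
  show "openin X W"
  proof (rule final_coverD(2)[OF S(2) W(1)])
    fix f assume f: "f \<in> S"
    show "openin (src f) {a \<in> topspace (src f). fn f a \<in> W}"
    proof (rule final_coverD(2)[OF R[OF f]])
      fix h assume "h \<in> pullback_sieve Top f R"
      then have h: "h \<in> Mor Top" "tgt h = src f" "Comp Top f h \<in> R"
        unfolding pullback_sieve_def by auto
      have "{b \<in> topspace (src h). fn h b \<in> {a \<in> topspace (src f). fn f a \<in> W}} =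
          {b \<in> topspace (src (Comp Top f h)). fn (Comp Top f h) b \<in> W}"
        using Mor_Top_point[OF h(1)] h(2) by auto
      then show "openin (src h) {b \<in> topspace (src h). fn h b \<in> {a \<in> topspace (src f). fn f a \<in> W}}"
        using W(2) h(3) by auto
    qed auto
  qed
qed

context
  assumes U: "universe TYPE('u)"
begin

text \<open>Constant maps with value in the image of a sieve belong to the sieve: they factor through
  a member.\<close>

lemma sieve_constant:
  fixes S :: "'u top_mor set"
  assumes S: "sieve Top X S" and r: "r \<in> S" "a \<in> topspace (src r)" and Z: "small (topspace Z)"
  shows "top_arrow Z X (\<lambda>_. fn r a) \<in> S"
proof -
  have rM: "r \<in> Mor Top" "tgt r = X" using S r(1) sieve_TopD by blast+
  then have k: "top_arrow Z (src r) (\<lambda>_. a) \<in> Mor Top"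
    using Z r(2) by (intro top_arrow_Mor) (auto dest: Mor_TopD)
  have "fn r a \<in> topspace X" using Mor_Top_point[OF rM(1) r(2)] rM(2) by simp
  then have "top_arrow Z X (\<lambda>_. fn r a) \<in> Mor Top"
    using Z Mor_TopD(2)[OF rM(1)] rM(2) by (intro top_arrow_Mor) auto
  then have "Comp Top r (top_arrow Z (src r) (\<lambda>_. a)) = top_arrow Z X (\<lambda>_. fn r a)"
    using k rM by (intro Comp_Top_eqI) auto
  then show ?thesis using sieve_Top_Comp[OF S r(1) k] by simp
qed

text \<open>If the sieve covers, a compatible family of maps out of its members descends to a map of
  sets because two points of members over the same point of \<open>X\<close> are seen by the same member,
  the map from a one-point space; finality is continuity of the descended map.\<close>

lemma final_cover_imp_colim_sieve:
  fixes S :: "'u top_mor set"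
  assumes S: "sieve Top X S" and fin: "final_cover X S"
  shows "colim_sieve Top X S"
  unfolding colim_sieve_iff_representable[OF category_Top S]
proof (intro ballI allI impI)
  fix Z :: "'u topology" and \<phi> assume Z: "Z \<in> Obj Top"
    and "matching_family Top (representable_presheaf Top Z) S \<phi>"
  then have \<phi>: "\<And>f. f \<in> S \<Longrightarrow> \<phi> f \<in> Mor Top" "\<And>f. f \<in> S \<Longrightarrow> src (\<phi> f) = src f" "\<And>f. f \<in> S \<Longrightarrow> tgt (\<phi> f) = Z"
    and comp: "\<And>f g. f \<in> S \<Longrightarrow> g \<in> Mor Top \<Longrightarrow> tgt g = src f \<Longrightarrow> \<phi> (Comp Top f g) = Comp Top (\<phi> f) g"
    unfolding matching_family_def representable_presheaf_def hom_def by auto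
  have X: "small (topspace X)" using S unfolding sieve_def by simp
  let ?pt = "discrete_topology {undefined :: 'u}"
  have pt: "small (topspace ?pt)" using small_finite[OF U, of "{undefined}"] by simp
  have eq: "fn (\<phi> f) a = fn (\<phi> f') a'"
    if f: "f \<in> S" "a \<in> topspace (src f)" and f': "f' \<in> S" "a' \<in> topspace (src f')" and e: "fn f a = fn f' a'"
    for f f' a a'
  proof -
    have M: "f \<in> Mor Top" "tgt f = X" "f' \<in> Mor Top" "tgt f' = X" using sieve_TopD[OF S] f f' by auto
    let ?g = "top_arrow ?pt (src f) (\<lambda>_. a)" and ?g' = "top_arrow ?pt (src f') (\<lambda>_. a')"
    have g: "?g \<in> Mor Top" "?g' \<in> Mor Top"
      using f f' pt M by (auto intro!: top_arrow_Mor dest: Mor_TopD)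
    have "Comp Top f ?g = Comp Top f' ?g'"
    proof (rule top_mor_eqI)
      show "Comp Top f ?g \<in> Mor Top" "Comp Top f' ?g' \<in> Mor Top"
        using Comp_Top_Mor[OF g(1) M(1)] Comp_Top_Mor[OF g(2) M(3)] by simp_all
    qed (use M e in auto)
    then have "Comp Top (\<phi> f) ?g = Comp Top (\<phi> f') ?g'"
      using comp[OF f(1) g(1)] comp[OF f'(1) g(2)] by simp
    from fn_cong_Comp[OF this, of undefined] show ?thesis by simp
  qed
  have "\<forall>x\<in>topspace X. \<exists>z. \<forall>f\<in>S. \<forall>a\<in>topspace (src f). fn f a = x \<longrightarrow> fn (\<phi> f) a = z"
    using eq by blast
  then obtain w where w: "\<And>x f a. x \<in> topspace X \<Longrightarrow> f \<in> S \<Longrightarrow> a \<in> topspace (src f) \<Longrightarrow> fn f a = x \<Longrightarrow>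
      fn (\<phi> f) a = w x"
    by metis
  have wf: "w (fn f a) = fn (\<phi> f) a" if "f \<in> S" "a \<in> topspace (src f)" for f a
    using w[OF _ that refl] Mor_Top_point[OF _ that(2)] sieve_TopD[OF S that(1)] by auto
  have "continuous_map X Z w"
    unfolding continuous_map_def
  proof (intro conjI allI impI)
    show "w \<in> topspace X \<rightarrow> topspace Z"
    proof
      fix x assume "x \<in> topspace X"
      then obtain f a where f: "f \<in> S" "a \<in> topspace (src f)" "fn f a = x"
        using final_coverD(1)[OF fin] by blast
      then show "w x \<in> topspace Z" using wf[OF f(1,2)] Mor_Top_point[OF \<phi>(1)[OF f(1)], of a] \<phi> by simp
    qed
    fix W assume W: "openin Z W"
    show "openin X {x \<in> topspace X. w x \<in> W}"
    proof (rule final_coverD(2)[OF fin])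
      fix f assume f: "f \<in> S"
      have "{a \<in> topspace (src f). fn f a \<in> {x \<in> topspace X. w x \<in> W}} =
          {a \<in> topspace (src (\<phi> f)). fn (\<phi> f) a \<in> W}"
        using wf[OF f] \<phi>(2)[OF f] Mor_Top_point sieve_TopD[OF S f] by auto
      then show "openin (src f) {a \<in> topspace (src f). fn f a \<in> {x \<in> topspace X. w x \<in> W}}"
        using openin_preimage_Mor[OF \<phi>(1)[OF f]] W \<phi>[OF f] by simp
    qed auto
  qed
  then have u: "top_arrow X Z w \<in> Mor Top" using X Z by (intro top_arrow_Mor) auto
  show "\<exists>!u. u \<in> hom Top X Z \<and> (\<forall>f\<in>S. Comp Top u f = \<phi> f)"
  proof (rule ex1I[of _ "top_arrow X Z w"], intro conjI ballI)
    show "top_arrow X Z w \<in> hom Top X Z" using u by (simp add: hom_def)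
    fix f assume f: "f \<in> S"
    have fM: "f \<in> Mor Top" "tgt f = X" using sieve_TopD[OF S f] .
    show "Comp Top (top_arrow X Z w) f = \<phi> f"
      using u fM \<phi>[OF f] wf[OF f] Mor_Top_point[OF fM(1)] by (intro Comp_Top_eqI) auto
  next
    fix v assume v: "v \<in> hom Top X Z \<and> (\<forall>f\<in>S. Comp Top v f = \<phi> f)"
    then have vM: "v \<in> Mor Top" "src v = X" "tgt v = Z" unfolding hom_def by auto
    show "v = top_arrow X Z w"
    proof (rule top_mor_eqI)
      fix x assume "x \<in> topspace (src v)"
      then obtain f a where f: "f \<in> S" "a \<in> topspace (src f)" "fn f a = x" and x: "x \<in> topspace X"
        using final_coverD(1)[OF fin] vM by blast
      then have "fn v x = fn (\<phi> f) a" using v Top_simps(6)[of a f v] by metis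
      then show "fn v x = fn (top_arrow X Z w) x" using wf[OF f(1,2)] f(3) x by simp
    qed (use vM u in auto)
  qed
qed

text \<open>Conversely, two maps from \<open>X\<close> into an indiscrete space may differ at a point missed by
  the sieve without differing on the sieve, and \<open>X\<close> with the final topology is the vertex of a
  cocone whose comparison map is the identity.\<close>

lemma colim_sieve_imp_final_cover:
  fixes S :: "'u top_mor set"
  assumes S: "sieve Top X S" and colim: "colim_sieve Top X S"
  shows "final_cover X S"
proof -
  have X: "small (topspace X)" using S unfolding sieve_def by simp
  have fS: "f \<in> Mor Top" "tgt f = X" if "f \<in> S" for f using sieve_TopD[OF S that] .
  have amalg: "\<exists>!u. u \<in> hom Top X Z \<and> (\<forall>f\<in>S. Comp Top u f = top_arrow (src f) Z (\<lambda>a. c (fn f a)))"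
    if Z: "small (topspace Z)" and c: "\<And>f. f \<in> S \<Longrightarrow> continuous_map (src f) Z (\<lambda>a. c (fn f a))" for Z c
  proof -
    let ?\<phi> = "\<lambda>f. top_arrow (src f) Z (\<lambda>a. c (fn f a))"
    have \<phi>: "?\<phi> f \<in> Mor Top" if "f \<in> S" for f
      using Mor_TopD(1)[OF fS(1)[OF that]] Z c[OF that] by (rule top_arrow_Mor)
    have "?\<phi> (Comp Top f g) = Comp Top (?\<phi> f) g" if "f \<in> S" "g \<in> Mor Top" "tgt g = src f" for f g
    proof (rule Comp_Top_eqI[symmetric])
      show "?\<phi> (Comp Top f g) \<in> Mor Top" using \<phi> sieve_Top_Comp[OF S that] by blast
    qed (use that \<phi> Mor_Top_point[OF that(2)] in auto)
    then have "matching_family Top (representable_presheaf Top Z) S ?\<phi>"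
      using \<phi> unfolding matching_family_def representable_presheaf_def hom_def by simp
    moreover have "Z \<in> Obj Top" using Z by simp
    ultimately show ?thesis
      using colim unfolding colim_sieve_iff_representable[OF category_Top S] by blast
  qed
  have cover: "\<exists>r\<in>S. \<exists>a\<in>topspace (src r). fn r a = x0" if x0: "x0 \<in> topspace X" for x0
  proof (rule ccontr)
    assume miss: "\<not> (\<exists>r\<in>S. \<exists>a\<in>topspace (src r). fn r a = x0)"
    obtain p q :: 'u where pq: "p \<noteq> q"
      using infinite_points[OF U] by (metis UNIV_I ex_new_if_finite finite.simps singletonI)
    define Z where "Z = pullback_topology {p, q} (\<lambda>_. ()) (discrete_topology UNIV)"
    have cont: "continuous_map Y Z h" if "h ` topspace Y \<subseteq> {p, q}" for h and Y :: "'u topology"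
      unfolding Z_def using that by (intro continuous_map_pullback') (auto simp: o_def)
    have Z: "small (topspace Z)"
      using small_finite[OF U, of "{p, q}"] unfolding Z_def topspace_pullback_topology by simp
    have "continuous_map (src f) Z (\<lambda>a. p)" for f :: "'u top_mor" by (rule cont) auto
    from amalg[OF Z this] have uniq: "u = v"
      if "u \<in> hom Top X Z" "\<forall>f\<in>S. Comp Top u f = top_arrow (src f) Z (\<lambda>a. p)"
        "v \<in> hom Top X Z" "\<forall>f\<in>S. Comp Top v f = top_arrow (src f) Z (\<lambda>a. p)" for u v
      using that by blast
    let ?m = "\<lambda>c. top_arrow X Z (\<lambda>x. if x = x0 then c else p)"
    have m: "?m c \<in> Mor Top" "\<And>f. f \<in> S \<Longrightarrow> Comp Top (?m c) f = top_arrow (src f) Z (\<lambda>a. p)"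
      if "c \<in> {p, q}" for c
    proof -
      show m: "?m c \<in> Mor Top" using X Z that by (intro top_arrow_Mor cont) auto
      fix f assume f: "f \<in> S"
      have "top_arrow (src f) Z (\<lambda>a. p) \<in> Mor Top"
        using Mor_TopD(1)[OF fS(1)[OF f]] Z by (intro top_arrow_Mor cont) auto
      then show "Comp Top (?m c) f = top_arrow (src f) Z (\<lambda>a. p)"
        using m fS[OF f] f miss Mor_Top_point[OF fS(1)[OF f]] by (intro Comp_Top_eqI) auto
    qed
    have "?m c \<in> hom Top X Z" "\<forall>f\<in>S. Comp Top (?m c) f = top_arrow (src f) Z (\<lambda>a. p)"
      if "c \<in> {p, q}" for c
      using m[OF that] by (simp_all add: hom_def)
    from uniq[OF this this] have "?m p = ?m q" by blast
    then have "fn (?m p) x0 = fn (?m q) x0" by simp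
    then show False using pq x0 by simp
  qed
  define op where "op W \<longleftrightarrow> W \<subseteq> topspace X \<and> (\<forall>r\<in>S. openin (src r) {a \<in> topspace (src r). fn r a \<in> W})" for W
  have "istopology op"
    unfolding istopology_def
  proof (intro conjI allI impI)
    fix V W assume "op V" "op W"
    moreover have "{a \<in> topspace (src r). fn r a \<in> V \<inter> W} =
        {a \<in> topspace (src r). fn r a \<in> V} \<inter> {a \<in> topspace (src r). fn r a \<in> W}" for r by auto
    ultimately show "op (V \<inter> W)" unfolding op_def by (auto simp del: Int_iff)
  next
    fix K assume K: "\<forall>V\<in>K. op V"
    have "{a \<in> topspace (src r). fn r a \<in> \<Union>K} = (\<Union>V\<in>K. {a \<in> topspace (src r). fn r a \<in> V})" for r
      by auto
    then show "op (\<Union>K)" using K unfolding op_def by (auto simp del: Union_iff)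
  qed
  define X' where "X' = topology op"
  have X': "openin X' W \<longleftrightarrow> op W" for W
    unfolding X'_def using \<open>istopology op\<close> by (simp add: topology_inverse')
  have opX: "op (topspace X)"
  proof -
    have "{a \<in> topspace (src r). fn r a \<in> topspace X} = topspace (src r)" if "r \<in> S" for r
      using Mor_Top_point fS[OF that] by auto
    then show ?thesis unfolding op_def by simp
  qed
  have sp: "topspace X' = topspace X"
  proof
    show "topspace X' \<subseteq> topspace X" using X'[of "topspace X'"] unfolding op_def by simp
    show "topspace X \<subseteq> topspace X'" using X' opX openin_subset by blast
  qed
  have cont: "continuous_map (src f) X' (\<lambda>a. fn f a)" if "f \<in> S" for f
    using that X' sp Mor_Top_point[OF fS(1)[OF that]] fS(2)[OF that]
    unfolding continuous_map_def op_def by auto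
  have "small (topspace X')" using X sp by simp
  from amalg[of X' "\<lambda>x. x", OF this cont]
  have "\<exists>u. u \<in> hom Top X X' \<and> (\<forall>f\<in>S. Comp Top u f = top_arrow (src f) X' (\<lambda>a. fn f a))"
    by (rule ex1_implies_ex)
  then obtain u where u: "u \<in> Mor Top" "src u = X" "tgt u = X'"
    and uf: "\<And>f. f \<in> S \<Longrightarrow> Comp Top u f = top_arrow (src f) X' (fn f)"
    by (auto simp: hom_def)
  have ux: "fn u x = x" if x: "x \<in> topspace X" for x
  proof -
    obtain f a where f: "f \<in> S" "a \<in> topspace (src f)" "fn f a = x" using cover[OF x] by blast
    then show ?thesis using uf[OF f(1)] Top_simps(6)[OF f(2), of u] by simp
  qed
  have "openin X W" if "op W" for W
  proof -
    have "openin X {x \<in> topspace X. fn u x \<in> W}"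
      using openin_preimage_Mor[OF u(1)] u that X' by simp
    moreover have "{x \<in> topspace X. fn u x \<in> W} = W" using ux that unfolding op_def by auto
    ultimately show ?thesis by simp
  qed
  then show ?thesis unfolding final_cover_def using cover op_def by blast
qed

lemma colim_sieve_iff_final_cover:
  fixes S :: "'u top_mor set"
  assumes "sieve Top X S"
  shows "colim_sieve Top X S \<longleftrightarrow> final_cover X S"
  using colim_sieve_imp_final_cover[OF assms] final_cover_imp_colim_sieve[OF assms] by (rule iffI)

lemma universal_colim_sieve_iff_final_cover:
  fixes S :: "'u top_mor set"
  assumes "sieve Top X S"
  shows "universal_colim_sieve Top X S \<longleftrightarrow>
    (\<forall>\<alpha>\<in>Mor Top. tgt \<alpha> = X \<longrightarrow> final_cover (src \<alpha>) (pullback_sieve Top \<alpha> S))"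
proof -
  have "sieve Top (src \<alpha>) (pullback_sieve Top \<alpha> S)" if "\<alpha> \<in> Mor Top" "tgt \<alpha> = X" for \<alpha>
    using sieve_pullback[OF category_Top assms, of \<alpha>] that by simp
  then show ?thesis
    unfolding universal_colim_sieve_def using colim_sieve_iff_final_cover by simp
qed

lemma universal_colim_sieve_mono:
  fixes S :: "'u top_mor set"
  assumes "universal_colim_sieve Top X S" "sieve Top X S" "sieve Top X R" "S \<subseteq> R"
  shows "universal_colim_sieve Top X R"
proof -
  have "pullback_sieve Top \<alpha> S \<subseteq> pullback_sieve Top \<alpha> R" for \<alpha>
    using assms(4) unfolding pullback_sieve_def by auto
  from final_cover_mono[OF _ this] show ?thesis
    using assms(1) universal_colim_sieve_iff_final_cover[OF assms(2)]
      universal_colim_sieve_iff_final_cover[OF assms(3)] by blast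
qed

lemma universal_colim_sieve_maximal:
  fixes X :: "'u topology"
  assumes "small (topspace X)"
  shows "universal_colim_sieve Top X {f \<in> Mor Top. tgt f = X}"
proof -
  have "final_cover (src \<alpha>) (pullback_sieve Top \<alpha> {f \<in> Mor Top. tgt f = X})"
    if "\<alpha> \<in> Mor Top" "tgt \<alpha> = X" for \<alpha>
  proof -
    let ?i = "top_arrow (src \<alpha>) (src \<alpha>) (\<lambda>y. y)"
    have i: "?i \<in> Mor Top" using that Mor_TopD by (intro top_arrow_Mor) auto
    have "final_cover (src \<alpha>) {?i}"
      unfolding final_cover_def
    proof (intro conjI allI impI ballI)
      fix W assume W: "W \<subseteq> topspace (src \<alpha>)"
        "\<forall>r\<in>{?i}. openin (src r) {a \<in> topspace (src r). fn r a \<in> W}"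
      then have "{a \<in> topspace (src \<alpha>). fn ?i a \<in> W} = W" by auto
      then show "openin (src \<alpha>) W" using W(2) by simp
    qed auto
    moreover have "?i \<in> pullback_sieve Top \<alpha> {f \<in> Mor Top. tgt f = X}"
      using i that Comp_Top_Mor[OF i, of \<alpha>] unfolding pullback_sieve_def by simp
    ultimately show ?thesis using final_cover_mono[of _ "{?i}"] by blast
  qed
  moreover have "sieve Top X {f \<in> Mor Top. tgt f = X}"
    using sieve_maximal[OF category_Top, of X] assms by simp
  ultimately show ?thesis using universal_colim_sieve_iff_final_cover by blast
qed

lemma universal_colim_sieve_transitive:
  fixes S :: "'u top_mor set"
  assumes S: "sieve Top X S" "universal_colim_sieve Top X S" and R: "sieve Top X R"
    and SR: "\<And>f. f \<in> S \<Longrightarrow> universal_colim_sieve Top (src f) (pullback_sieve Top f R)"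
  shows "universal_colim_sieve Top X R"
  unfolding universal_colim_sieve_iff_final_cover[OF R]
proof (intro ballI impI)
  fix \<alpha> :: "'u top_mor" assume \<alpha>: "\<alpha> \<in> Mor Top" "tgt \<alpha> = X"
  show "final_cover (src \<alpha>) (pullback_sieve Top \<alpha> R)"
  proof (rule final_cover_transitive)
    show "\<forall>f\<in>pullback_sieve Top \<alpha> S. f \<in> Mor Top" unfolding pullback_sieve_def by simp
    show "final_cover (src \<alpha>) (pullback_sieve Top \<alpha> S)"
      using S \<alpha> universal_colim_sieve_iff_final_cover by blast
    fix h assume "h \<in> pullback_sieve Top \<alpha> S"
    then have h: "h \<in> Mor Top" "tgt h = src \<alpha>" "Comp Top \<alpha> h \<in> S" unfolding pullback_sieve_def by auto
    have M: "Comp Top \<alpha> h \<in> Mor Top" "tgt (Comp Top \<alpha> h) = X" using sieve_TopD[OF S(1) h(3)] .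
    have sv: "sieve Top (src h) (pullback_sieve Top (Comp Top \<alpha> h) R)"
      using sieve_pullback[OF category_Top R M(1)] M by simp
    then have "final_cover (src h) (pullback_sieve Top (Comp Top \<alpha> h) R)"
      using universal_colim_sieve_imp_colim_sieve[OF category_Top SR[OF h(3)]]
        colim_sieve_iff_final_cover[OF sv] by simp
    then show "final_cover (src h) (pullback_sieve Top h (pullback_sieve Top \<alpha> R))"
      using pullback_pullback_sieve[OF category_Top, of \<alpha> h R] \<alpha> h by simp
  qed
qed

end

section \<open>Universal quotient maps and universal colim sieves\<close>

lemma subset_image_iff_ex: "B \<subseteq> f ` A \<longleftrightarrow> (\<forall>x\<in>B. \<exists>a\<in>A. f a = x)"
proof
  show "B \<subseteq> f ` A \<Longrightarrow> \<forall>x\<in>B. \<exists>a\<in>A. f a = x" by blast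
  show "\<forall>x\<in>B. \<exists>a\<in>A. f a = x \<Longrightarrow> B \<subseteq> f ` A" by (rule subsetI) (metis imageI)
qed

lemma quotient_map_iff_final_cover:
  assumes "f \<in> Mor Top"
  shows "quotient_map (src f) (tgt f) (fn f) \<longleftrightarrow> final_cover (tgt f) {f}"
proof -
  have "fn f ` topspace (src f) = topspace (tgt f) \<longleftrightarrow>
      (\<forall>x\<in>topspace (tgt f). \<exists>a\<in>topspace (src f). fn f a = x)"
    using Mor_Top_point[OF assms] unfolding set_eq_subset subset_image_iff_ex
    by (simp add: image_subset_iff)
  moreover have "openin (src f) {a \<in> topspace (src f). fn f a \<in> W}" if "openin (tgt f) W" for W
    using openin_preimage_Mor[OF assms that] .
  ultimately show ?thesis
    unfolding quotient_map_def final_cover_def ball_simps by blast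
qed

lemma coprod_quotient_map_iff_final_cover:
  assumes F: "family_on Top X F"
  shows "quotient_map (coprod_space F) X (coprod_map F) \<longleftrightarrow> final_cover X (snd F ` fst F)"
proof -
  have f: "snd F i \<in> Mor Top" "tgt (snd F i) = X" if "i \<in> fst F" for i
    using F that unfolding family_on_def by auto
  have sp: "topspace (coprod_space F) = (SIGMA i:fst F. topspace (src (snd F i)))"
    unfolding coprod_space_def by (simp add: o_def)
  have op: "openin (coprod_space F) {c \<in> topspace (coprod_space F). coprod_map F c \<in> W} \<longleftrightarrow>
      (\<forall>r\<in>snd F ` fst F. openin (src r) {a \<in> topspace (src r). fn r a \<in> W})" for W
  proof -
    have "{c \<in> topspace (coprod_space F). coprod_map F c \<in> W} =
        (SIGMA i:fst F. {a \<in> topspace (src (snd F i)). fn (snd F i) a \<in> W})"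
      unfolding sp coprod_map_def by auto
    then show ?thesis unfolding coprod_space_def by (simp add: openin_disjoint_union)
  qed
  have im: "coprod_map F ` topspace (coprod_space F) = topspace X \<longleftrightarrow>
      (\<forall>x\<in>topspace X. \<exists>r\<in>snd F ` fst F. \<exists>a\<in>topspace (src r). fn r a = x)"
  proof -
    have "coprod_map F c \<in> topspace X" if "c \<in> topspace (coprod_space F)" for c
      using that f Mor_Top_point unfolding sp coprod_map_def by fastforce
    then have "coprod_map F ` topspace (coprod_space F) = topspace X \<longleftrightarrow>
        (\<forall>x\<in>topspace X. \<exists>c\<in>topspace (coprod_space F). coprod_map F c = x)"
      unfolding set_eq_subset subset_image_iff_ex by (simp add: image_subset_iff)
    then show ?thesis unfolding sp coprod_map_def by simp
  qed
  have "openin (src r) {a \<in> topspace (src r). fn r a \<in> W}"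
    if "openin X W" "r \<in> snd F ` fst F" for W r
    using that f openin_preimage_Mor[of r W] by auto
  then show ?thesis unfolding quotient_map_def final_cover_def op im by blast
qed

lemma fibre_product_cong:
  assumes "\<And>y. y \<in> topspace Y \<Longrightarrow> g y = g' y"
  shows "fibre_product Y g A q = fibre_product Y g' A q"
proof -
  have "topspace (prod_topology Y A) \<inter> {(y, a). g y = q a} =
      topspace (prod_topology Y A) \<inter> {(y, a). g' y = q a}"
    using assms by auto
  then show ?thesis unfolding fibre_product_def by (metis subtopology_restrict)
qed

lemma quotient_map_fibre_product_fst:
  "quotient_map (fibre_product Y g A q) Y fst \<longleftrightarrow>
    (\<forall>y\<in>topspace Y. \<exists>a\<in>topspace A. q a = g y) \<and>
    (\<forall>W\<subseteq>topspace Y. openin (fibre_product Y g A q) {w \<in> topspace (fibre_product Y g A q). fst w \<in> W}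
        \<longrightarrow> openin Y W)"
proof -
  have "fst ` topspace (fibre_product Y g A q) = topspace Y \<longleftrightarrow>
      (\<forall>y\<in>topspace Y. \<exists>a\<in>topspace A. q a = g y)"
    unfolding topspace_fibre_product by (force simp: image_iff)
  moreover have "openin (fibre_product Y g A q) {w \<in> topspace (fibre_product Y g A q). fst w \<in> W}"
    if "openin Y W" for W
    using openin_continuous_map_preimage[OF continuous_map_fibre_product_fst that] .
  ultimately show ?thesis unfolding quotient_map_def by blast
qed

text \<open>Pullback distributes over coproducts.\<close>

lemma openin_fibre_product_coprod:
  fixes F :: "('i, 'u top_mor) family"
  shows "openin (fibre_product Y g (coprod_space F) (coprod_map F))
      {w \<in> topspace (fibre_product Y g (coprod_space F) (coprod_map F)). fst w \<in> W} \<longleftrightarrow>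
    (\<forall>r\<in>snd F ` fst F. openin (fibre_product Y g (src r) (fn r))
      {w \<in> topspace (fibre_product Y g (src r) (fn r)). fst w \<in> W})"
    (is "openin ?P ?W \<longleftrightarrow> _")
proof
  assume W: "openin ?P ?W"
  show "\<forall>r\<in>snd F ` fst F. openin (fibre_product Y g (src r) (fn r))
      {w \<in> topspace (fibre_product Y g (src r) (fn r)). fst w \<in> W}"
  proof (intro ballI)
    fix r assume "r \<in> snd F ` fst F"
    then obtain i where i: "i \<in> fst F" "r = snd F i" by blast
    let ?Q = "fibre_product Y g (src r) (fn r)"
    have Q: "fst w \<in> topspace Y" "snd w \<in> topspace (src r)" "g (fst w) = fn r (snd w)"
      if "w \<in> topspace ?Q" for w
      using that unfolding topspace_fibre_product by auto
    have "continuous_map (src r) (coprod_space F) (Pair i)"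
      unfolding coprod_space_def i(2) using continuous_map_component_injection[OF i(1)] by fast
    then have c: "continuous_map ?Q (coprod_space F) (\<lambda>w. (i, snd w))"
      using continuous_map_compose[OF continuous_map_fibre_product_snd] by (fastforce simp: o_def)
    have j: "continuous_map ?Q ?P (\<lambda>w. (fst w, (i, snd w)))"
      using Q i(2) by (intro continuous_map_into_fibre_product c)
        (auto simp: coprod_map_def intro: continuous_map_fibre_product_fst)
    have "{w \<in> topspace ?Q. (fst w, (i, snd w)) \<in> ?W} = {w \<in> topspace ?Q. fst w \<in> W}"
      using continuous_map_image_subset_topspace[OF j] by auto
    then show "openin ?Q {w \<in> topspace ?Q. fst w \<in> W}"
      using openin_continuous_map_preimage[OF j W] by simp
  qed
next
  assume R: "\<forall>r\<in>snd F ` fst F. openin (fibre_product Y g (src r) (fn r))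
      {w \<in> topspace (fibre_product Y g (src r) (fn r)). fst w \<in> W}"
  have "\<exists>N V. openin Y N \<and> openin (coprod_space F) V \<and> y \<in> N \<and> c \<in> V \<and>
      (\<forall>y'\<in>N. \<forall>c'\<in>V. g y' = coprod_map F c' \<longrightarrow> (y', c') \<in> ?W)" if yc: "(y, c) \<in> ?W" for y c
  proof -
    obtain i a where c: "c = (i, a)" by (cases c)
    have i: "i \<in> fst F" and a: "a \<in> topspace (src (snd F i))" and y: "y \<in> topspace Y" "y \<in> W"
      and e: "g y = fn (snd F i) a"
      using yc unfolding c topspace_fibre_product coprod_space_def coprod_map_def by auto
    let ?r = "snd F i"
    have "openin (fibre_product Y g (src ?r) (fn ?r))
        {w \<in> topspace (fibre_product Y g (src ?r) (fn ?r)). fst w \<in> W}"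
      using R i by blast
    moreover have "(y, a) \<in> {w \<in> topspace (fibre_product Y g (src ?r) (fn ?r)). fst w \<in> W}"
      using a y e unfolding topspace_fibre_product by simp
    ultimately obtain N V where NV: "openin Y N" "openin (src ?r) V" "y \<in> N" "a \<in> V"
      "\<forall>y'\<in>N. \<forall>a'\<in>V. g y' = fn ?r a' \<longrightarrow>
          (y', a') \<in> {w \<in> topspace (fibre_product Y g (src ?r) (fn ?r)). fst w \<in> W}"
      unfolding openin_fibre_product by blast
    have "openin (coprod_space F) (Pair i ` V)"
      using open_map_component_injection[OF i, of "\<lambda>i. src (snd F i)"] NV(2)
      unfolding open_map_def coprod_space_def by blast
    moreover have "(y', c') \<in> ?W" if y': "y' \<in> N" and c': "c' \<in> Pair i ` V" and e': "g y' = coprod_map F c'" for y' c'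
    proof -
      obtain a' where a': "c' = (i, a')" "a' \<in> V" using c' by blast
      then have "g y' = fn ?r a'" using e' unfolding coprod_map_def by simp
      then have "(y', a') \<in> {w \<in> topspace (fibre_product Y g (src ?r) (fn ?r)). fst w \<in> W}"
        using NV(5) y' a'(2) by blast
      then show ?thesis
        using a' i e' unfolding topspace_fibre_product coprod_space_def by simp
    qed
    ultimately show ?thesis
      using NV c by (intro exI[of _ N] exI[of _ "Pair i ` V"]) auto
  qed
  then show "openin ?P ?W" unfolding openin_fibre_product by blast
qed

context
  assumes U: "universe TYPE('u)"
begin

text \<open>Finality of a pulled back sieve is tested on the fibre products with the members, because
  these are, up to homeomorphism, members of the pulled back sieve.\<close>

lemma openin_fibre_product_sieve:
  fixes S :: "'u top_mor set"
  assumes S: "sieve Top X S" and r: "r \<in> S" and \<alpha>: "\<alpha> \<in> Mor Top" "tgt \<alpha> = X"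
    and W: "\<And>h. h \<in> pullback_sieve Top \<alpha> S \<Longrightarrow> openin (src h) {b \<in> topspace (src h). fn h b \<in> W}"
  shows "openin (fibre_product (src \<alpha>) (fn \<alpha>) (src r) (fn r))
    {w \<in> topspace (fibre_product (src \<alpha>) (fn \<alpha>) (src r) (fn r)). fst w \<in> W}"
proof -
  let ?P = "fibre_product (src \<alpha>) (fn \<alpha>) (src r) (fn r)"
  have rM: "r \<in> Mor Top" "tgt r = X" using sieve_TopD[OF S r] .
  then obtain p q e where pb: "is_pullback Top r \<alpha> p q" and e: "continuous_map ?P (src q) e"
    and qe: "\<And>y a. (y, a) \<in> topspace ?P \<Longrightarrow> fn q (e (y, a)) = y \<and> fn p (e (y, a)) = a"
    using Top_pullback_exists[OF U rM(1) \<alpha>(1)] \<alpha>(2) by metis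
  have pq: "p \<in> Mor Top" "tgt p = src r" "q \<in> Mor Top" "tgt q = src \<alpha>" "Comp Top r p = Comp Top \<alpha> q"
    using pb unfolding is_pullback_def by auto
  then have "Comp Top \<alpha> q \<in> S" using sieve_Top_Comp[OF S r pq(1,2)] by simp
  then have "q \<in> pullback_sieve Top \<alpha> S" using pq unfolding pullback_sieve_def by simp
  from openin_continuous_map_preimage[OF e W[OF this]]
  have "openin ?P {w \<in> topspace ?P. e w \<in> {b \<in> topspace (src q). fn q b \<in> W}}" .
  moreover have "{w \<in> topspace ?P. e w \<in> {b \<in> topspace (src q). fn q b \<in> W}} = {w \<in> topspace ?P. fst w \<in> W}"
    using continuous_map_image_subset_topspace[OF e] qe by fastforce
  ultimately show ?thesis by simp
qed

lemma final_cover_pullback_generated_sieve: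
  fixes R :: "'u top_mor set"
  assumes R: "\<forall>r\<in>R. r \<in> Mor Top \<and> tgt r = tgt \<alpha>" and \<alpha>: "\<alpha> \<in> Mor Top"
  shows "final_cover (src \<alpha>) (pullback_sieve Top \<alpha> (generated_sieve Top R)) \<longleftrightarrow>
    (\<forall>y\<in>topspace (src \<alpha>). \<exists>r\<in>R. \<exists>a\<in>topspace (src r). fn r a = fn \<alpha> y) \<and>
    (\<forall>W\<subseteq>topspace (src \<alpha>).
      (\<forall>r\<in>R. openin (fibre_product (src \<alpha>) (fn \<alpha>) (src r) (fn r))
        {w \<in> topspace (fibre_product (src \<alpha>) (fn \<alpha>) (src r) (fn r)). fst w \<in> W}) \<longrightarrow>
      openin (src \<alpha>) W)"
proof -
  let ?P = "\<lambda>r. fibre_product (src \<alpha>) (fn \<alpha>) (src r) (fn r)"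
  let ?S = "generated_sieve Top R"
  have S: "sieve Top (tgt \<alpha>) ?S"
    using sieve_generated[OF category_Top, of "tgt \<alpha>" R] R Mor_TopD(2)[OF \<alpha>] by simp
  have RS: "R \<subseteq> ?S" using generated_sieve_superset[OF category_Top] R by blast
  have mem: "\<exists>r\<in>R. \<exists>k\<in>Mor Top. tgt k = src r \<and> src k = src h \<and> (\<forall>b\<in>topspace (src h). fn \<alpha> (fn h b) = fn r (fn k b))"
    if "h \<in> pullback_sieve Top \<alpha> ?S" for h
  proof -
    from that obtain r k where k: "r \<in> R" "k \<in> Mor Top" "tgt k = src r" and e: "Comp Top \<alpha> h = Comp Top r k"
      unfolding pullback_sieve_def generated_sieve_def by auto
    have "src k = src h" using arg_cong[OF e, of src] by simp
    then show ?thesis using k fn_cong_Comp[OF e] by auto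
  qed
  have cover: "(\<exists>h\<in>pullback_sieve Top \<alpha> ?S. \<exists>b\<in>topspace (src h). fn h b = y) \<longleftrightarrow>
      (\<exists>r\<in>R. \<exists>a\<in>topspace (src r). fn r a = fn \<alpha> y)" if y: "y \<in> topspace (src \<alpha>)" for y
  proof
    assume "\<exists>h\<in>pullback_sieve Top \<alpha> ?S. \<exists>b\<in>topspace (src h). fn h b = y"
    then obtain h b where h: "h \<in> pullback_sieve Top \<alpha> ?S" "b \<in> topspace (src h)" "fn h b = y" by blast
    then obtain r k where "r \<in> R" and k: "k \<in> Mor Top" "tgt k = src r" "src k = src h"
      "fn \<alpha> (fn h b) = fn r (fn k b)"
      using mem[OF h(1)] by blast
    moreover have "fn k b \<in> topspace (src r)" using Mor_Top_point[OF k(1), of b] k h by simp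
    ultimately show "\<exists>r\<in>R. \<exists>a\<in>topspace (src r). fn r a = fn \<alpha> y" using h(3) by force
  next
    assume "\<exists>r\<in>R. \<exists>a\<in>topspace (src r). fn r a = fn \<alpha> y"
    then obtain r a where r: "r \<in> R" "a \<in> topspace (src r)" "fn r a = fn \<alpha> y" by blast
    let ?c = "top_arrow (src \<alpha>) (src \<alpha>) (\<lambda>_. y)"
    have c: "?c \<in> Mor Top" using Mor_TopD(1)[OF \<alpha>] y by (intro top_arrow_Mor) auto
    have "top_arrow (src \<alpha>) (tgt \<alpha>) (\<lambda>_. fn r a) \<in> ?S"
      using sieve_constant[OF U S _ r(2) Mor_TopD(1)[OF \<alpha>]] RS r(1) by blast
    moreover from this have "top_arrow (src \<alpha>) (tgt \<alpha>) (\<lambda>_. fn r a) \<in> Mor Top" using sieve_TopD[OF S] by blast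
    then have "Comp Top \<alpha> ?c = top_arrow (src \<alpha>) (tgt \<alpha>) (\<lambda>_. fn r a)"
      using c \<alpha> r by (intro Comp_Top_eqI) auto
    ultimately have "?c \<in> pullback_sieve Top \<alpha> ?S" using c unfolding pullback_sieve_def by simp
    moreover have "fn ?c y = y" using y by simp
    ultimately show "\<exists>h\<in>pullback_sieve Top \<alpha> ?S. \<exists>b\<in>topspace (src h). fn h b = y"
      using y by (intro bexI[of _ ?c] bexI[of _ y]) auto
  qed
  have op: "(\<forall>h\<in>pullback_sieve Top \<alpha> ?S. openin (src h) {b \<in> topspace (src h). fn h b \<in> W}) \<longleftrightarrow>
      (\<forall>r\<in>R. openin (?P r) {w \<in> topspace (?P r). fst w \<in> W})" for W
  proof
    assume "\<forall>h\<in>pullback_sieve Top \<alpha> ?S. openin (src h) {b \<in> topspace (src h). fn h b \<in> W}"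
    then show "\<forall>r\<in>R. openin (?P r) {w \<in> topspace (?P r). fst w \<in> W}"
      using openin_fibre_product_sieve[OF S _ \<alpha> refl] RS by blast
  next
    assume W: "\<forall>r\<in>R. openin (?P r) {w \<in> topspace (?P r). fst w \<in> W}"
    show "\<forall>h\<in>pullback_sieve Top \<alpha> ?S. openin (src h) {b \<in> topspace (src h). fn h b \<in> W}"
    proof
      fix h assume h: "h \<in> pullback_sieve Top \<alpha> ?S"
      then obtain r k where r: "r \<in> R" and k: "k \<in> Mor Top" "tgt k = src r" "src k = src h"
        "\<And>b. b \<in> topspace (src h) \<Longrightarrow> fn \<alpha> (fn h b) = fn r (fn k b)"
        using mem[OF h] by blast
      have hM: "h \<in> Mor Top" "tgt h = src \<alpha>" using h unfolding pullback_sieve_def by auto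
      have j: "continuous_map (src h) (?P r) (\<lambda>b. (fn h b, fn k b))"
      proof (rule continuous_map_into_fibre_product)
        show "continuous_map (src h) (src \<alpha>) (fn h)" using Mor_TopD(3)[OF hM(1)] hM(2) by simp
        show "continuous_map (src h) (src r) (fn k)" using Mor_TopD(3)[OF k(1)] k(2,3) by simp
      qed (use k(4) in blast)
      have "{b \<in> topspace (src h). (fn h b, fn k b) \<in> {w \<in> topspace (?P r). fst w \<in> W}} =
          {b \<in> topspace (src h). fn h b \<in> W}"
        using continuous_map_image_subset_topspace[OF j] by auto
      moreover have "openin (src h) {b \<in> topspace (src h). (fn h b, fn k b) \<in> {w \<in> topspace (?P r). fst w \<in> W}}"
        by (rule openin_continuous_map_preimage[OF j]) (use W r in blast)
      ultimately show "openin (src h) {b \<in> topspace (src h). fn h b \<in> W}" by simp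
    qed
  qed
  show ?thesis unfolding final_cover_def op using cover by (simp cong: ball_cong)
qed

text \<open>Both sides are conditions on fibre products over \<open>X\<close>, by
  \<open>quotient_map_fibre_product_fst\<close> and \<open>final_cover_pullback_generated_sieve\<close>, so they agree as soon
  as the fibre products with \<open>A\<close> have the same images and open sets as those with the members
  of \<open>R\<close> together.  This is the case for the coproduct of a family and for the source of
  a single map.\<close>

lemma universal_quotient_map_iff_universal_colim_sieve:
  fixes R :: "'u top_mor set" and A :: "'a topology"
  assumes X: "small (topspace X)" and R: "\<forall>r\<in>R. r \<in> Mor Top \<and> tgt r = X"
    and quot: "quotient_map A X q \<longleftrightarrow> final_cover X R"
    and pts: "\<And>x. (\<exists>a\<in>topspace A. q a = x) \<longleftrightarrow> (\<exists>r\<in>R. \<exists>a\<in>topspace (src r). fn r a = x)"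
    and op: "\<And>(Y :: 'u topology) g W.
      openin (fibre_product Y g A q) {w \<in> topspace (fibre_product Y g A q). fst w \<in> W} \<longleftrightarrow>
      (\<forall>r\<in>R. openin (fibre_product Y g (src r) (fn r))
        {w \<in> topspace (fibre_product Y g (src r) (fn r)). fst w \<in> W})"
  shows "universal_quotient_map A X q \<longleftrightarrow> universal_colim_sieve Top X (generated_sieve Top R)"
proof -
  let ?S = "generated_sieve Top R"
  have S: "sieve Top X ?S" using sieve_generated[OF category_Top, of X R] R X by simp
  have pullback: "quotient_map (fibre_product (src \<alpha>) (fn \<alpha>) A q) (src \<alpha>) fst \<longleftrightarrow>
      final_cover (src \<alpha>) (pullback_sieve Top \<alpha> ?S)" if \<alpha>: "\<alpha> \<in> Mor Top" "tgt \<alpha> = X" for \<alpha>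
    using final_cover_pullback_generated_sieve[OF _ \<alpha>(1), of R] R \<alpha>(2)
    unfolding quotient_map_fibre_product_fst op pts by simp
  have base: "quotient_map A X q" if "universal_colim_sieve Top X ?S"
  proof -
    have "final_cover X ?S"
      using universal_colim_sieve_imp_colim_sieve[OF category_Top that S]
        colim_sieve_iff_final_cover[OF U S] by simp
    then show ?thesis using final_cover_generated_sieve[of R] R quot by blast
  qed
  show ?thesis
  proof
    assume "universal_quotient_map A X q"
    then have "quotient_map (fibre_product (src \<alpha>) (fn \<alpha>) A q) (src \<alpha>) fst"
      if "\<alpha> \<in> Mor Top" "tgt \<alpha> = X" for \<alpha>
      using Mor_TopD[OF that(1)] that(2) unfolding universal_quotient_map_def by blast
    then show "universal_colim_sieve Top X ?S"
      unfolding universal_colim_sieve_iff_final_cover[OF U S] using pullback by blast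
  next
    assume S': "universal_colim_sieve Top X ?S"
    have "quotient_map (fibre_product Y g A q) Y fst"
      if Y: "small (topspace Y)" "continuous_map Y X g" for Y :: "'u topology" and g
    proof -
      have \<alpha>: "top_arrow Y X g \<in> Mor Top" using top_arrow_Mor[OF Y(1) X Y(2)] .
      have "final_cover (src (top_arrow Y X g)) (pullback_sieve Top (top_arrow Y X g) ?S)"
        using S' \<alpha> top_arrow_simps(2) unfolding universal_colim_sieve_iff_final_cover[OF U S] by blast
      then have "quotient_map (fibre_product Y (fn (top_arrow Y X g)) A q) Y fst"
        using pullback[OF \<alpha>] by simp
      then show ?thesis using fibre_product_cong[of Y "fn (top_arrow Y X g)" g A q] by simp
    qed
    then show "universal_quotient_map A X q"
      using base[OF S'] unfolding universal_quotient_map_def by blast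
  qed
qed

lemma coprod_universal_quotient_map_iff:
  fixes F :: "('i, 'u top_mor) family"
  assumes "small (topspace X)" "family_on Top X F"
  shows "universal_quotient_map (coprod_space F) X (coprod_map F) \<longleftrightarrow>
    universal_colim_sieve Top X (generated_sieve Top (snd F ` fst F))"
proof (rule universal_quotient_map_iff_universal_colim_sieve)
  show "\<forall>r\<in>snd F ` fst F. r \<in> Mor Top \<and> tgt r = X"
    using assms(2) unfolding family_on_def by auto
  show "(\<exists>c\<in>topspace (coprod_space F). coprod_map F c = x) \<longleftrightarrow>
      (\<exists>r\<in>snd F ` fst F. \<exists>a\<in>topspace (src r). fn r a = x)" for x
    unfolding coprod_space_def coprod_map_def by force
qed (use assms in \<open>simp_all add: coprod_quotient_map_iff_final_cover openin_fibre_product_coprod del: image_iff\<close>)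

lemma universal_quotient_map_iff:
  fixes f :: "'u top_mor"
  assumes "f \<in> Mor Top"
  shows "universal_quotient_map (src f) (tgt f) (fn f) \<longleftrightarrow>
    universal_colim_sieve Top (tgt f) (generated_sieve Top {f})"
proof (rule universal_quotient_map_iff_universal_colim_sieve)
  show "small (topspace (tgt f))" using Mor_TopD(2)[OF assms] .
  show "quotient_map (src f) (tgt f) (fn f) \<longleftrightarrow> final_cover (tgt f) {f}"
    using quotient_map_iff_final_cover[OF assms] .
qed (use assms in simp_all)

end

section \<open>Reduction to small families\<close>

lemma final_cover_witness:
  assumes "final_cover Y Q" "W \<subseteq> topspace Y" "W \<noteq> {}"
  shows "\<exists>h\<in>Q. (\<exists>a\<in>topspace (src h). fn h a \<in> W) \<and>
    (openin (src h) {a \<in> topspace (src h). fn h a \<in> W} \<longrightarrow> openin Y W)"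
proof (cases "openin Y W")
  case True
  then obtain y where "y \<in> W" "y \<in> topspace Y" using assms by blast
  then show ?thesis using True final_coverD(1)[OF assms(1), of y] by blast
next
  case False
  then obtain h where h: "h \<in> Q" "\<not> openin (src h) {a \<in> topspace (src h). fn h a \<in> W}"
    using final_coverD(2)[OF assms(1,2)] by blast
  moreover have "{a \<in> topspace (src h). fn h a \<in> W} \<noteq> {}" using h(2) by (metis openin_empty)
  ultimately show ?thesis by blast
qed

context
  assumes U: "universe TYPE('u)"
begin

text \<open>Universality has to be tested against all spaces over \<open>X\<close>, which form a proper class.  This
  criterion leaves only the refinements of the topology of \<open>X\<close>, and in each of them only the
  singletons.

  Let \<open>W\<close> be a set of points of \<open>Z\<close> that looks open to the pullback along \<open>\<alpha> : Z \<rightarrow> X\<close>, and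
  let \<open>z \<in> W\<close>, \<open>x = \<alpha> z\<close>.  Let \<open>Y\<close> be \<open>X\<close> with all points but \<open>x\<close> made isolated, and
  with the sets containing \<open>x\<close> and \<open>\<alpha> (N - W)\<close>, for \<open>N\<close> a neighbourhood of \<open>z\<close>, as
  neighbourhoods of \<open>x\<close>.  If \<open>x\<close> is isolated in \<open>Y\<close> as well, then near \<open>z\<close> the set \<open>W\<close>
  contains everything outside the fibre over \<open>x\<close>, and inside this fibre it is open because
  constant maps lie in the sieve; so it is a neighbourhood of \<open>z\<close>.  If \<open>x\<close> is not isolated,
  the criterion provides a member \<open>r\<close> such that the fibre of \<open>r\<close> over \<open>x\<close> is not open.  But
  for \<open>a\<close> in this fibre, openness of \<open>W\<close> in the fibre product at \<open>(z, a)\<close> gives \<open>N\<close>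
  and \<open>V\<close> such that \<open>\<alpha> (N - W)\<close> misses \<open>r V\<close>.  So \<open>r V\<close> meets some neighbourhood of
  \<open>x\<close> in \<open>Y\<close> in \<open>x\<close> only, and the fibre is a neighbourhood of \<open>a\<close>.\<close>

lemma universal_colim_sieve_by_refinements:
  fixes R :: "'u top_mor set"
  assumes R: "sieve Top X R"
    and refine: "\<And>Y x. topspace Y = topspace X \<Longrightarrow> continuous_map Y X (\<lambda>y. y) \<Longrightarrow> x \<in> topspace X \<Longrightarrow>
      \<exists>r\<in>R. continuous_map (src r) Y (fn r) \<and> (\<exists>a\<in>topspace (src r). fn r a = x) \<and>
        (openin (src r) {a \<in> topspace (src r). fn r a = x} \<longrightarrow> openin Y {x})"
  shows "universal_colim_sieve Top X R"
  unfolding universal_colim_sieve_iff_final_cover[OF U R]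
proof (intro ballI impI)
  fix \<alpha> :: "'u top_mor" assume \<alpha>: "\<alpha> \<in> Mor Top" "tgt \<alpha> = X"
  let ?Z = "src \<alpha>"
  let ?S = "pullback_sieve Top \<alpha> R"
  have Z: "small (topspace ?Z)" using Mor_TopD(1)[OF \<alpha>(1)] .
  have \<alpha>Z: "fn \<alpha> z \<in> topspace X" if "z \<in> topspace ?Z" for z
    using Mor_Top_point[OF \<alpha>(1) that] \<alpha>(2) by simp
  have covered: "\<exists>r\<in>R. \<exists>a\<in>topspace (src r). fn r a = x" if "x \<in> topspace X" for x
    using refine[OF refl, of x] that continuous_map_id[of X] by (auto simp: id_def)
  \<comment> \<open>The inclusion of a part of a fibre of \<open>\<alpha>\<close> becomes constant in \<open>X\<close>.\<close>
  have fibre: "top_arrow (subtopology ?Z A) ?Z (\<lambda>y. y) \<in> ?S"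
    if A: "A \<subseteq> topspace ?Z" "\<And>y. y \<in> A \<Longrightarrow> fn \<alpha> y = x" and x: "x \<in> topspace X" for A x
  proof -
    let ?i = "top_arrow (subtopology ?Z A) ?Z (\<lambda>y. y)"
    have sm: "small (topspace (subtopology ?Z A))"
      using small_subset[OF U Z] by simp
    have "continuous_map (subtopology ?Z A) ?Z (\<lambda>y. y)"
      using continuous_map_from_subtopology[OF continuous_map_id] by (simp add: id_def)
    then have i: "?i \<in> Mor Top" using sm Z by (intro top_arrow_Mor)
    obtain r a where r: "r \<in> R" "a \<in> topspace (src r)" "fn r a = x" using covered[OF x] by blast
    have c: "top_arrow (subtopology ?Z A) X (\<lambda>_. fn r a) \<in> R" using sieve_constant[OF U R r(1,2) sm] .
    have "Comp Top \<alpha> ?i = top_arrow (subtopology ?Z A) X (\<lambda>_. fn r a)"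
      by (rule Comp_Top_eqI[OF i \<alpha>(1) sieve_TopD(1)[OF R c]]) (use \<alpha>(2) A r(3) in auto)
    then show ?thesis using c i unfolding pullback_sieve_def by simp
  qed
  show "final_cover ?Z ?S"
    unfolding final_cover_def
  proof (intro conjI ballI allI impI)
    fix y assume y: "y \<in> topspace ?Z"
    then have "top_arrow (subtopology ?Z {y}) ?Z (\<lambda>y. y) \<in> ?S"
      using fibre[of "{y}" "fn \<alpha> y"] \<alpha>Z by simp
    then show "\<exists>h\<in>?S. \<exists>a\<in>topspace (src h). fn h a = y"
      using y by (intro bexI[of _ "top_arrow (subtopology ?Z {y}) ?Z (\<lambda>y. y)"] bexI[of _ y]) auto
  next
    fix W assume W: "W \<subseteq> topspace ?Z"
      "\<forall>h\<in>?S. openin (src h) {b \<in> topspace (src h). fn h b \<in> W}"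
    have "\<exists>N. openin ?Z N \<and> z \<in> N \<and> N \<subseteq> W" if z: "z \<in> W" for z
    proof -
      have zZ: "z \<in> topspace ?Z" using z W(1) by blast
      define x where "x = fn \<alpha> z"
      have x: "x \<in> topspace X" unfolding x_def using \<alpha>Z[OF zZ] .
      \<comment> \<open>The open sets of \<open>Y\<close>.\<close>
      define op where "op B \<longleftrightarrow> B \<subseteq> topspace X \<and>
        (x \<in> B \<longrightarrow> (\<exists>N. openin ?Z N \<and> z \<in> N \<and> (\<forall>z'\<in>N - W. fn \<alpha> z' \<in> B)))" for B
      have "istopology op"
        unfolding istopology_def
      proof (intro conjI allI impI)
        fix A B assume A: "op A" and B: "op B"
        have "\<exists>N. openin ?Z N \<and> z \<in> N \<and> (\<forall>z'\<in>N - W. fn \<alpha> z' \<in> A \<inter> B)" if xAB: "x \<in> A \<inter> B"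
        proof -
          obtain M N where "openin ?Z M" "z \<in> M" "\<forall>z'\<in>M - W. fn \<alpha> z' \<in> A"
            "openin ?Z N" "z \<in> N" "\<forall>z'\<in>N - W. fn \<alpha> z' \<in> B"
            using A B xAB unfolding op_def by blast
          then show ?thesis by (intro exI[of _ "M \<inter> N"]) auto
        qed
        then show "op (A \<inter> B)" using A unfolding op_def by blast
      next
        fix K assume K: "\<forall>B\<in>K. op B"
        have "\<exists>N. openin ?Z N \<and> z \<in> N \<and> (\<forall>z'\<in>N - W. fn \<alpha> z' \<in> \<Union>K)" if x: "x \<in> \<Union>K"
        proof -
          obtain B where "B \<in> K" "x \<in> B" using x by blast
          moreover from this obtain N where "openin ?Z N" "z \<in> N" "\<forall>z'\<in>N - W. fn \<alpha> z' \<in> B"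
            using K unfolding op_def by blast
          ultimately show ?thesis by (intro exI[of _ N]) auto
        qed
        moreover have "\<Union>K \<subseteq> topspace X" using K unfolding op_def by blast
        ultimately show "op (\<Union>K)" unfolding op_def by blast
      qed
      then have Y: "openin (topology op) B \<longleftrightarrow> op B" for B by (simp add: topology_inverse')
      have opX: "op B" if "openin X B" for B
      proof -
        have "openin ?Z {z' \<in> topspace ?Z. fn \<alpha> z' \<in> B}"
          using openin_preimage_Mor[OF \<alpha>(1)] \<alpha>(2) that by simp
        moreover have "z \<in> {z' \<in> topspace ?Z. fn \<alpha> z' \<in> B}" if "x \<in> B"
          using zZ that unfolding x_def by simp
        ultimately show ?thesis using openin_subset[OF that] unfolding op_def by blast
      qed
      have sp: "topspace (topology op) = topspace X"
      proof
        show "topspace (topology op) \<subseteq> topspace X"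
          using Y[of "topspace (topology op)"] unfolding op_def by simp
        show "topspace X \<subseteq> topspace (topology op)"
          using Y opX[OF openin_topspace] openin_subset by blast
      qed
      have "continuous_map (topology op) X (\<lambda>y. y)"
      proof -
        have "openin (topology op) {y \<in> topspace X. y \<in> B}" if "openin X B" for B
        proof -
          have "{y \<in> topspace X. y \<in> B} = B" using openin_subset[OF that] by blast
          then show ?thesis using Y opX[OF that] by simp
        qed
        then show ?thesis unfolding continuous_map_def sp by simp
      qed
      from refine[OF sp this x] obtain r where r: "r \<in> R" "continuous_map (src r) (topology op) (fn r)"
        and ra: "\<exists>a\<in>topspace (src r). fn r a = x"
        and iso: "openin (src r) {a \<in> topspace (src r). fn r a = x} \<longrightarrow> op {x}"
        unfolding Y by blast
      \<comment> \<open>The fibre of \<open>r\<close> over \<open>x\<close> is open in any case, so \<open>x\<close> is isolated in \<open>Y\<close>.\<close>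
      have "\<exists>V'. openin (src r) V' \<and> a \<in> V' \<and> V' \<subseteq> {a \<in> topspace (src r). fn r a = x}"
        if a: "a \<in> topspace (src r)" "fn r a = x" for a
      proof -
        let ?P = "fibre_product ?Z (fn \<alpha>) (src r) (fn r)"
        have "openin ?P {w \<in> topspace ?P. fst w \<in> W}"
          using openin_fibre_product_sieve[OF U R r(1) \<alpha>] W(2) by blast
        moreover have "(z, a) \<in> {w \<in> topspace ?P. fst w \<in> W}"
          using z zZ a unfolding topspace_fibre_product x_def by simp
        ultimately obtain N V where N: "openin ?Z N" "z \<in> N" and V: "openin (src r) V" "a \<in> V"
          and NV: "\<forall>z'\<in>N. \<forall>a'\<in>V. fn \<alpha> z' = fn r a' \<longrightarrow> (z', a') \<in> {w \<in> topspace ?P. fst w \<in> W}"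
          unfolding openin_fibre_product by blast
        define B where "B = {b \<in> topspace X. b = x \<or> b \<notin> fn r ` V}"
        have "fn \<alpha> z' \<in> B" if z': "z' \<in> N - W" for z'
        proof -
          have "fn \<alpha> z' \<noteq> fn r a'" if "a' \<in> V" for a' using NV z' that by auto
          moreover have "z' \<in> topspace ?Z" using N(1) z' openin_subset by blast
          ultimately show ?thesis using \<alpha>Z unfolding B_def by blast
        qed
        then have "op B" using N unfolding op_def B_def by blast
        then have "openin (src r) {b \<in> topspace (src r). fn r b \<in> B}"
          using openin_continuous_map_preimage[OF r(2)] Y by blast
        then have "openin (src r) ({b \<in> topspace (src r). fn r b \<in> B} \<inter> V)"
          using V(1) by (rule openin_Int)
        moreover have "a \<in> {b \<in> topspace (src r). fn r b \<in> B} \<inter> V"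
          using a V x unfolding B_def by simp
        moreover have "{b \<in> topspace (src r). fn r b \<in> B} \<inter> V \<subseteq> {a \<in> topspace (src r). fn r a = x}"
          unfolding B_def by blast
        ultimately show ?thesis by blast
      qed
      then have "openin (src r) {a \<in> topspace (src r). fn r a = x}"
        by (subst openin_subopen) blast
      then have "op {x}" using iso by blast
      then obtain M where M: "openin ?Z M" "z \<in> M" "\<And>z'. z' \<in> M - W \<Longrightarrow> fn \<alpha> z' = x"
        unfolding op_def by auto
      define A where "A = {z' \<in> topspace ?Z. fn \<alpha> z' = x}"
      let ?i = "top_arrow (subtopology ?Z A) ?Z (\<lambda>y. y)"
      have "?i \<in> ?S" by (rule fibre[OF _ _ x]) (auto simp: A_def)
      then have "openin (src ?i) {b \<in> topspace (src ?i). fn ?i b \<in> W}" using W(2) by blast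
      moreover have "{b \<in> topspace (src ?i). fn ?i b \<in> W} = A \<inter> W"
        unfolding A_def by auto
      ultimately have "openin (subtopology ?Z A) (A \<inter> W)" by simp
      then obtain N where N: "openin ?Z N" "A \<inter> W = N \<inter> A"
        unfolding openin_subtopology by blast
      have "z \<in> N" using N(2) z zZ unfolding A_def x_def by blast
      moreover have "M \<inter> N \<subseteq> W"
        using M(3) N(2) openin_subset[OF N(1)] unfolding A_def by blast
      ultimately show ?thesis using M N(1) by (intro exI[of _ "M \<inter> N"]) auto
    qed
    then show "openin ?Z W" by (subst openin_subopen) blast
  qed
qed

lemma small_family_of_set:
  assumes "(R :: 'u top_mor set) \<prec> (UNIV :: 'u set)"
  obtains F :: "('u, 'u top_mor) family" where "small (fst F)" "snd F ` fst F = R"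
proof -
  obtain e :: "'u top_mor \<Rightarrow> 'u" where e: "inj_on e R" "small (e ` R)"
    using lesspoll_embedding[OF U assms] .
  have "inv_into R e ` e ` R = R" using e(1) by (rule inv_into_image_cancel[OF _ subset_refl])
  then show thesis using that[of "(e ` R, inv_into R e)"] e(2) by simp
qed

lemma lesspoll_points_image:
  assumes "(A :: 'a set) \<prec> (UNIV :: 'u set)"
  shows "f ` A \<prec> (UNIV :: 'u set)"
  using image_lepoll assms by (rule lesspoll_trans1)

text \<open>Choose for each nonempty set of points \<open>W\<close> a member that meets \<open>W\<close> and, if \<open>W\<close> is not open, shows
  this.  The singletons among the sets \<open>W\<close> make the chosen members cover \<open>X\<close>.\<close>

lemma final_cover_small_subset:
  fixes S :: "'u top_mor set"
  assumes X: "small (topspace X)" and S: "final_cover X S"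
  obtains R where "R \<subseteq> S" "R \<prec> (UNIV :: 'u set)" "final_cover X R"
proof -
  have "\<forall>W\<in>Pow (topspace X) - {{}}. \<exists>h\<in>S. (\<exists>a\<in>topspace (src h). fn h a \<in> W) \<and>
      (openin (src h) {a \<in> topspace (src h). fn h a \<in> W} \<longrightarrow> openin X W)"
    using final_cover_witness[OF S] by blast
  then obtain s where s: "\<forall>W\<in>Pow (topspace X) - {{}}. s W \<in> S \<and> (\<exists>a\<in>topspace (src (s W)). fn (s W) a \<in> W) \<and>
      (openin (src (s W)) {a \<in> topspace (src (s W)). fn (s W) a \<in> W} \<longrightarrow> openin X W)"
    by metis
  let ?R = "s ` (Pow (topspace X) - {{}})"
  show thesis
  proof
    show "?R \<subseteq> S" using s by blast
    have "Pow (topspace X) \<prec> (UNIV :: 'u set)"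
      using Pow_lesspoll_points[OF U] X unfolding small_def by blast
    then have "Pow (topspace X) - {{}} \<prec> (UNIV :: 'u set)"
      by (rule lesspoll_trans1[OF subset_imp_lepoll[OF Diff_subset]])
    then show "?R \<prec> (UNIV :: 'u set)" by (rule lesspoll_points_image)
    show "final_cover X ?R"
      unfolding final_cover_def
    proof (intro conjI ballI allI impI)
      fix x assume "x \<in> topspace X"
      then have "{x} \<in> Pow (topspace X) - {{}}" by simp
      moreover from this have "\<exists>a\<in>topspace (src (s {x})). fn (s {x}) a = x" using bspec[OF s, of "{x}"] by simp
      ultimately show "\<exists>r\<in>?R. \<exists>a\<in>topspace (src r). fn r a = x" by blast
    next
      fix W assume W: "W \<subseteq> topspace X" "\<forall>r\<in>?R. openin (src r) {a \<in> topspace (src r). fn r a \<in> W}"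
      show "openin X W"
      proof (cases "W = {}")
        case False
        then have "W \<in> Pow (topspace X) - {{}}" using W(1) by simp
        then show ?thesis using bspec[OF s, of W] W(2) by blast
      qed simp
    qed
  qed
qed

lemma refinements_lesspoll_points:
  assumes "small (topspace (X :: 'u topology))"
  shows "{Y. topspace Y = topspace X \<and> continuous_map Y X (\<lambda>y. y)} \<prec> (UNIV :: 'u set)"
proof -
  let ?T = "{Y. topspace Y = topspace X \<and> continuous_map Y X (\<lambda>y. y)}"
  have "inj_on (\<lambda>Y. Collect (openin Y)) ?T"
    by (rule inj_onI) (simp add: topology_eq set_eq_iff)
  moreover have "(\<lambda>Y. Collect (openin Y)) ` ?T \<subseteq> Pow (Pow (topspace X))"
    using openin_subset by fastforce
  ultimately have "?T \<lesssim> Pow (Pow (topspace X))"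
    unfolding lepoll_def by (intro exI conjI)
  moreover have "Pow (Pow (topspace X)) \<prec> (UNIV :: 'u set)"
    using assms unfolding small_def by (intro Pow_lesspoll_points[OF U])
  ultimately show ?thesis by (rule lesspoll_trans1)
qed

text \<open>The refinements of the topology of \<open>X\<close> and the points of \<open>X\<close> are few enough to choose one
  member for each pair of them.\<close>

lemma universal_colim_sieve_small_subset:
  fixes S :: "'u top_mor set"
  assumes S: "sieve Top X S" "universal_colim_sieve Top X S"
  obtains R where "R \<subseteq> S" "R \<prec> (UNIV :: 'u set)" "universal_colim_sieve Top X (generated_sieve Top R)"
proof -
  have X: "small (topspace X)" using S(1) unfolding sieve_def by simp
  let ?T = "{Y. topspace Y = topspace X \<and> continuous_map Y X (\<lambda>y. y)}"
  let ?ok = "\<lambda>Y x r. continuous_map (src r) Y (fn r) \<and> (\<exists>a\<in>topspace (src r). fn r a = x) \<and>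
      (openin (src r) {a \<in> topspace (src r). fn r a = x} \<longrightarrow> openin Y {x})"
  have ex: "\<exists>r. r \<in> S \<and> ?ok Y x r" if Y: "Y \<in> ?T" and x: "x \<in> topspace X" for Y x
  proof -
    let ?\<iota> = "top_arrow Y X (\<lambda>y. y)"
    have \<iota>: "?\<iota> \<in> Mor Top" using X Y by (intro top_arrow_Mor) auto
    have "final_cover Y (pullback_sieve Top ?\<iota> S)"
      using S(2) \<iota> unfolding universal_colim_sieve_iff_final_cover[OF U S(1)]
      by (metis top_arrow_simps(1,2))
    from final_cover_witness[OF this, of "{x}"] obtain h where h: "h \<in> pullback_sieve Top ?\<iota> S"
      "\<exists>a\<in>topspace (src h). fn h a = x"
      "openin (src h) {a \<in> topspace (src h). fn h a = x} \<longrightarrow> openin Y {x}"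
      using x Y by auto
    have hM: "h \<in> Mor Top" "tgt h = Y" "Comp Top ?\<iota> h \<in> S" using h(1) unfolding pullback_sieve_def by auto
    have e: "fn (Comp Top ?\<iota> h) a = fn h a" if "a \<in> topspace (src h)" for a
      using Mor_Top_point[OF hM(1) that] hM(2) that by simp
    have "continuous_map (src h) Y (fn (Comp Top ?\<iota> h))"
      by (rule continuous_map_eq[OF Mor_TopD(3)[OF hM(1), unfolded hM(2)]]) (rule e[symmetric])
    moreover have "{a \<in> topspace (src h). fn (Comp Top ?\<iota> h) a = x} = {a \<in> topspace (src h). fn h a = x}"
      using e by auto
    ultimately have "?ok Y x (Comp Top ?\<iota> h)" using h(2,3) e by auto
    then show ?thesis using hM(3) by blast
  qed
  have "\<forall>Yx\<in>?T \<times> topspace X. \<exists>r. r \<in> S \<and> ?ok (fst Yx) (snd Yx) r"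
    by (rule ballI, rule ex) (simp_all add: mem_Times_iff)
  from bchoice[OF this] obtain s
    where s: "\<forall>Yx\<in>?T \<times> topspace X. s Yx \<in> S \<and> ?ok (fst Yx) (snd Yx) (s Yx)" ..
  let ?R = "s ` (?T \<times> topspace X)"
  have RS: "?R \<subseteq> S" using s by blast
  then have R: "\<forall>r\<in>?R. r \<in> Mor Top \<and> tgt r = X" using sieve_TopD[OF S(1)] by blast
  show thesis
  proof
    show "?R \<subseteq> S" using RS .
    have "?T \<times> topspace X \<prec> (UNIV :: 'u set)"
      using X unfolding small_def
      by (intro Sigma_lesspoll_points[OF U] refinements_lesspoll_points) (simp_all add: small_def)
    then show "?R \<prec> (UNIV :: 'u set)" by (rule lesspoll_points_image)
    show "universal_colim_sieve Top X (generated_sieve Top ?R)"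
    proof (rule universal_colim_sieve_by_refinements)
      show "sieve Top X (generated_sieve Top ?R)"
        using sieve_generated[OF category_Top, of X ?R] R X by simp
      have sub: "?R \<subseteq> generated_sieve Top ?R"
        using generated_sieve_superset[OF category_Top, of ?R] R by blast
      fix Y x assume "topspace Y = topspace X" "continuous_map Y X (\<lambda>y. y)" "x \<in> topspace X"
      then have "(Y, x) \<in> ?T \<times> topspace X" by simp
      then have "s (Y, x) \<in> generated_sieve Top ?R" "?ok Y x (s (Y, x))"
        using sub bspec[OF s, of "(Y, x)"] by (blast, simp)
      then show "\<exists>r\<in>generated_sieve Top ?R. ?ok Y x r" by blast
    qed
  qed
qed

end

section \<open>The canonical topology\<close>

lemma family_on_iff: "family_on Top X F \<longleftrightarrow> (\<forall>r\<in>snd F ` fst F. r \<in> Mor Top \<and> tgt r = X)"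
  unfolding family_on_def by auto

lemma sieve_generated_Top:
  assumes "small (topspace X)" "family_on Top X F"
  shows "sieve Top X (generated_sieve Top (snd F ` fst F))"
  using sieve_generated[OF category_Top, of X "snd F ` fst F"] assms
  unfolding family_on_iff by simp

context
  assumes U: "universe TYPE('u)"
begin

lemma K_Top_iff:
  fixes X :: "'u topology"
  assumes "small (topspace X)"
  shows "F \<in> K_Top X \<longleftrightarrow> small (fst F) \<and> family_on Top X F \<and>
    universal_colim_sieve Top X (generated_sieve Top (snd F ` fst F))"
  using coprod_universal_quotient_map_iff[OF U assms] unfolding K_Top_def by blast

lemma colim_sieve_iff_quotient_family:
  fixes S :: "'u top_mor set"
  assumes S: "sieve Top X S"
  shows "colim_sieve Top X S \<longleftrightarrow>
    (\<exists>F :: ('u, 'u top_mor) family. small (fst F) \<and> snd F ` fst F \<subseteq> S \<and>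
      quotient_map (coprod_space F) X (coprod_map F))"
proof -
  have fam: "family_on Top X F" if "snd F ` fst F \<subseteq> S" for F :: "('u, 'u top_mor) family"
    using that sieve_TopD[OF S] unfolding family_on_iff by blast
  show ?thesis
    unfolding colim_sieve_iff_final_cover[OF U S]
  proof
    assume "final_cover X S"
    moreover have "small (topspace X)" using S unfolding sieve_def by simp
    ultimately obtain R where R: "R \<subseteq> S" "R \<prec> (UNIV :: 'u set)" "final_cover X R"
      using final_cover_small_subset[OF U] by metis
    obtain F :: "('u, 'u top_mor) family" where F: "small (fst F)" "snd F ` fst F = R"
      using small_family_of_set[OF U R(2)] .
    then show "\<exists>F :: ('u, 'u top_mor) family. small (fst F) \<and> snd F ` fst F \<subseteq> S \<and>
        quotient_map (coprod_space F) X (coprod_map F)"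
      using R coprod_quotient_map_iff_final_cover[OF fam[of F]] by (intro exI[of _ F]) simp
  next
    assume "\<exists>F :: ('u, 'u top_mor) family. small (fst F) \<and> snd F ` fst F \<subseteq> S \<and>
        quotient_map (coprod_space F) X (coprod_map F)"
    then obtain F :: "('u, 'u top_mor) family" where "snd F ` fst F \<subseteq> S"
      "quotient_map (coprod_space F) X (coprod_map F)" by blast
    then show "final_cover X S"
      using coprod_quotient_map_iff_final_cover[OF fam[of F]] final_cover_mono by blast
  qed
qed

lemma universal_colim_sieve_iff_universal_quotient_family:
  fixes S :: "'u top_mor set"
  assumes S: "sieve Top X S"
  shows "universal_colim_sieve Top X S \<longleftrightarrow>
    (\<exists>F :: ('u, 'u top_mor) family. small (fst F) \<and> snd F ` fst F \<subseteq> S \<and>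
      universal_quotient_map (coprod_space F) X (coprod_map F))"
proof -
  have X: "small (topspace X)" using S unfolding sieve_def by simp
  have fam: "family_on Top X F" if "snd F ` fst F \<subseteq> S" for F :: "('u, 'u top_mor) family"
    using that sieve_TopD[OF S] unfolding family_on_iff by blast
  show ?thesis
  proof
    assume "universal_colim_sieve Top X S"
    then obtain R where R: "R \<subseteq> S" "R \<prec> (UNIV :: 'u set)"
      "universal_colim_sieve Top X (generated_sieve Top R)"
      using universal_colim_sieve_small_subset[OF U S] by metis
    obtain F :: "('u, 'u top_mor) family" where F: "small (fst F)" "snd F ` fst F = R"
      using small_family_of_set[OF U R(2)] .
    then show "\<exists>F :: ('u, 'u top_mor) family. small (fst F) \<and> snd F ` fst F \<subseteq> S \<and>
        universal_quotient_map (coprod_space F) X (coprod_map F)"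
      using R coprod_universal_quotient_map_iff[OF U X fam[of F]] by (intro exI[of _ F]) simp
  next
    assume "\<exists>F :: ('u, 'u top_mor) family. small (fst F) \<and> snd F ` fst F \<subseteq> S \<and>
        universal_quotient_map (coprod_space F) X (coprod_map F)"
    then obtain F :: "('u, 'u top_mor) family" where F: "snd F ` fst F \<subseteq> S"
      "universal_quotient_map (coprod_space F) X (coprod_map F)" by blast
    then have "universal_colim_sieve Top X (generated_sieve Top (snd F ` fst F))"
      using coprod_universal_quotient_map_iff[OF U X fam[of F]] by blast
    then show "universal_colim_sieve Top X S"
      using universal_colim_sieve_mono[OF U _ sieve_generated_Top[OF X fam[OF F(1)]] S]
        generated_sieve_least[OF category_Top S F(1)] by blast
  qed
qed

lemma generated_topology_K_Top:
  fixes X :: "'u topology"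
  shows "S \<in> generated_topology Top K_Top X \<longleftrightarrow> sieve Top X S \<and> universal_colim_sieve Top X S"
proof -
  have "family_on Top X F" if "sieve Top X S" "snd F ` fst F \<subseteq> S" for F :: "('u, 'u top_mor) family"
    using that sieve_TopD unfolding family_on_iff by blast
  then show ?thesis
    unfolding generated_topology_def K_Top_def
    using universal_colim_sieve_iff_universal_quotient_family[of X S] by blast
qed

lemma generated_topology_K_Top_canonical:
  "is_canonical_topology (Top :: ('u topology, 'u top_mor) cat) (generated_topology Top K_Top)"
proof -
  let ?J = "generated_topology Top K_Top :: 'u topology \<Rightarrow> 'u top_mor set set"
  have sv: "\<forall>X\<in>Obj Top. \<forall>S\<in>?J X. sieve Top X S"
    using generated_topology_K_Top by blast
  have top: "grothendieck_topology Top ?J"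
    unfolding grothendieck_topology_def
  proof (intro conjI ballI allI impI)
    fix X :: "'u topology" assume X: "X \<in> Obj Top"
    then show "{f \<in> Mor Top. Cod Top f = X} \<in> ?J X"
      using sieve_maximal[OF category_Top X] universal_colim_sieve_maximal[OF U, of X]
      unfolding generated_topology_K_Top by simp
  next
    fix g :: "'u top_mor" and S assume g: "g \<in> Mor Top" and "S \<in> ?J (Cod Top g)"
    then show "pullback_sieve Top g S \<in> ?J (Dom Top g)"
      unfolding generated_topology_K_Top
      using sieve_pullback[OF category_Top _ g] universal_colim_sieve_pullback[OF category_Top _ g]
      by blast
  next
    fix X :: "'u topology" and S R assume "S \<in> ?J X"
      and R: "sieve Top X R \<and> (\<forall>f\<in>S. pullback_sieve Top f R \<in> ?J (Dom Top f))"
    then have S: "sieve Top X S" "universal_colim_sieve Top X S"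
      and SR: "\<And>f. f \<in> S \<Longrightarrow> universal_colim_sieve Top (src f) (pullback_sieve Top f R)"
      unfolding generated_topology_K_Top by simp_all
    show "R \<in> ?J X"
      unfolding generated_topology_K_Top
      using universal_colim_sieve_transitive[OF U S _ SR] R by blast
  qed (use sv in blast)
  moreover have "subcanonical Top ?J"
    unfolding subcanonical_iff_colim_sieve[OF category_Top sv]
    by (intro ballI universal_colim_sieve_imp_colim_sieve[OF category_Top])
      (simp_all add: generated_topology_K_Top)
  moreover have "J' X \<subseteq> ?J X"
    if J': "grothendieck_topology Top J'" "subcanonical Top J'" and X: "X \<in> Obj Top" for J' X
  proof
    fix S assume S: "S \<in> J' X"
    have "sieve Top X S" using J'(1) X S unfolding grothendieck_topology_def by blast
    then show "S \<in> ?J X"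
      using subcanonical_imp_universal_colim_sieve[OF category_Top J' X S]
      unfolding generated_topology_K_Top by blast
  qed
  ultimately show ?thesis unfolding is_canonical_topology_def by blast
qed

text \<open>Through the generated sieves the axioms of a basis become properties of universal colim
  sieves: an isomorphism generates the maximal sieve, pulled back families generate pulled back
  sieves, and composite families are handled by transitivity.\<close>

lemma K_Top_iso:
  fixes f :: "'u \<Rightarrow> 'u top_mor"
  assumes "iso_mor Top (f i)"
  shows "({i}, f) \<in> K_Top (tgt (f i))"
proof -
  from assms have f: "f i \<in> Mor Top" unfolding iso_mor_def by simp
  then have X: "small (topspace (tgt (f i)))" by (rule Mor_TopD)
  obtain g where g: "g \<in> Mor Top" "src g = tgt (f i)" "tgt g = src (f i)"
    "Comp Top (f i) g = Id Top (tgt (f i))"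
    using assms unfolding iso_mor_def hom_def by auto
  have "h \<in> generated_sieve Top {f i}" if h: "h \<in> Mor Top" "tgt h = tgt (f i)" for h
  proof -
    have "h = Comp Top (Id Top (Cod Top h)) h" using Id_Comp[OF category_Top h(1)] by simp
    also have "\<dots> = Comp Top (f i) (Comp Top g h)"
      using Comp_assoc[OF category_Top h(1) g(1) f] h g by simp
    finally show ?thesis
      unfolding generated_sieve_def using Comp_Top_Mor[OF h(1) g(1)] h g
      by (intro CollectI bexI[of _ "f i"] bexI[of _ "Comp Top g h"]) auto
  qed
  then have sub: "{h \<in> Mor Top. tgt h = tgt (f i)} \<subseteq> generated_sieve Top (snd ({i}, f) ` fst ({i}, f))"
    by auto
  have fam: "family_on Top (tgt (f i)) ({i}, f)" using f unfolding family_on_def by simp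
  have max: "sieve Top (tgt (f i)) {h \<in> Mor Top. tgt h = tgt (f i)}"
    using sieve_maximal[OF category_Top, of "tgt (f i)"] X by simp
  show ?thesis
    unfolding K_Top_iff[OF X]
    using fam small_finite[OF U, of "{i}"]
      universal_colim_sieve_mono[OF U universal_colim_sieve_maximal[OF U X] max
        sieve_generated_Top[OF X fam] sub]
    by simp
qed

lemma K_Top_stable:
  fixes g :: "'u top_mor"
  assumes g: "g \<in> Mor Top" and K: "(I, f) \<in> K_Top (tgt g)"
    and pb: "\<forall>i\<in>I. is_pullback Top (f i) g (p i) (q i)"
  shows "(I, q) \<in> K_Top (src g)"
proof -
  have X: "small (topspace (tgt g))" "small (topspace (src g))" using Mor_TopD[OF g] by auto
  have I: "small I" and f: "universal_colim_sieve Top (tgt g) (generated_sieve Top (f ` I))"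
    using K unfolding K_Top_iff[OF X(1)] by simp_all
  have "universal_colim_sieve Top (src g) (generated_sieve Top (q ` I))"
    using universal_colim_sieve_pullback[OF category_Top f g]
      pullback_generated_sieve[OF category_Top pb g] by simp
  moreover have "family_on Top (src g) (I, q)"
    using pb unfolding family_on_def is_pullback_def by simp
  ultimately show ?thesis unfolding K_Top_iff[OF X(2)] using I by simp
qed

lemma K_Top_compose:
  fixes X :: "'u topology"
  assumes X: "small (topspace X)" and f: "(I, f) \<in> K_Top X"
    and g: "\<forall>i\<in>I. (J i, g i) \<in> K_Top (src (f i))"
    and b: "bij_betw b L (SIGMA i:I. J i)"
    and h: "\<forall>l\<in>L. \<forall>i j. b l = (i, j) \<longrightarrow> h l = Comp Top (f i) (g i j)"
  shows "(L, h) \<in> K_Top X"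
proof -
  have I: "small I" and fX: "family_on Top X (I, f)"
    and fU: "universal_colim_sieve Top X (generated_sieve Top (f ` I))"
    using f unfolding K_Top_iff[OF X] by simp_all
  have fM: "f i \<in> Mor Top" "tgt (f i) = X" if "i \<in> I" for i
    using fX that unfolding family_on_def by auto
  have J: "small (J i)" and gX: "family_on Top (src (f i)) (J i, g i)"
    and gU: "universal_colim_sieve Top (src (f i)) (generated_sieve Top (g i ` J i))" if "i \<in> I" for i
    using bspec[OF g that] unfolding K_Top_iff[OF Mor_TopD(1)[OF fM(1)[OF that]]] by simp_all
  have gM: "g i j \<in> Mor Top" "tgt (g i j) = src (f i)" if "i \<in> I" "j \<in> J i" for i j
    using gX[OF that(1)] that(2) unfolding family_on_def by auto
  have "(SIGMA i:I. J i) \<prec> (UNIV :: 'u set)"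
    using I J unfolding small_def by (intro Sigma_lesspoll_points[OF U])
  moreover have "L \<approx> (SIGMA i:I. J i)" using b unfolding eqpoll_def by blast
  ultimately have L: "small L" unfolding small_def by (metis eq_lesspoll_trans)
  have "h l \<in> Mor Top \<and> tgt (h l) = X" if l: "l \<in> L" for l
  proof -
    obtain i j where ij: "b l = (i, j)" by (cases "b l")
    then have i: "i \<in> I" and j: "j \<in> J i" using bij_betwE[OF b] l by auto
    have "h l = Comp Top (f i) (g i j)" using h l ij by blast
    then show ?thesis using Comp_Top_Mor[OF gM(1)[OF i j] fM(1)[OF i] gM(2)[OF i j]] fM(2)[OF i] by simp
  qed
  then have hX: "family_on Top X (L, h)" unfolding family_on_def by simp
  let ?S = "generated_sieve Top (f ` I)" and ?R = "generated_sieve Top (h ` L)"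
  have S: "sieve Top X ?S" and R: "sieve Top X ?R"
    using sieve_generated_Top[OF X fX] sieve_generated_Top[OF X hX] by simp_all
  have hR: "h ` L \<subseteq> ?R"
    using generated_sieve_superset[OF category_Top, of "h ` L"] hX unfolding family_on_def by auto
  \<comment> \<open>Pulled back along \<open>f i\<close>, the sieve of the composites contains the sieve of \<open>g i\<close>.\<close>
  have fR: "universal_colim_sieve Top (src (f i)) (pullback_sieve Top (f i) ?R)" if i: "i \<in> I" for i
  proof (rule universal_colim_sieve_mono[OF U gU[OF i]])
    show "sieve Top (src (f i)) (generated_sieve Top (g i ` J i))"
      using sieve_generated_Top[OF Mor_TopD(1)[OF fM(1)[OF i]] gX[OF i]] by simp
    show fiR: "sieve Top (src (f i)) (pullback_sieve Top (f i) ?R)"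
      using sieve_pullback[OF category_Top R fM(1)[OF i]] fM(2)[OF i] by simp
    have "g i j \<in> pullback_sieve Top (f i) ?R" if j: "j \<in> J i" for j
    proof -
      have "(i, j) \<in> b ` L" using b i j unfolding bij_betw_def by simp
      then obtain l where "l \<in> L" "b l = (i, j)" by force
      then have "Comp Top (f i) (g i j) \<in> h ` L" using h by force
      then show ?thesis using hR gM[OF i j] unfolding pullback_sieve_def by auto
    qed
    then show "generated_sieve Top (g i ` J i) \<subseteq> pullback_sieve Top (f i) ?R"
      using generated_sieve_least[OF category_Top fiR] by blast
  qed
  have "universal_colim_sieve Top X ?R"
  proof (rule universal_colim_sieve_transitive[OF U S fU R])
    fix s assume "s \<in> ?S"
    then obtain i k where i: "i \<in> I" and k: "k \<in> Mor Top" "tgt k = src (f i)" "s = Comp Top (f i) k"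
      unfolding generated_sieve_def by auto
    have "universal_colim_sieve Top (src k) (pullback_sieve Top k (pullback_sieve Top (f i) ?R))"
      using universal_colim_sieve_pullback[OF category_Top fR[OF i] k(1)] k(2) by simp
    then show "universal_colim_sieve Top (src s) (pullback_sieve Top s ?R)"
      using pullback_pullback_sieve[OF category_Top fM(1)[OF i] k(1)] k(2,3) by simp
  qed
  then show ?thesis unfolding K_Top_iff[OF X] using L hX by simp
qed

lemma grothendieck_basis_K_Top:
  "grothendieck_basis (Top :: ('u topology, 'u top_mor) cat) K_Top"
proof -
  obtain p :: "'u \<times> 'u \<Rightarrow> 'u" where p: "inj p" using pairing_of_points[OF U] .
  show ?thesis
    unfolding grothendieck_basis_def
  proof (intro conjI ballI allI impI)
    fix X :: "'u topology" and F :: "('u, 'u top_mor) family" assume "F \<in> K_Top X"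
    then show "family_on Top X F" unfolding K_Top_def by simp
  next
    fix i and f :: "'u \<Rightarrow> 'u top_mor" assume "iso_mor Top (f i)"
    then show "({i}, f) \<in> K_Top (Cod Top (f i))" using K_Top_iso by simp
  next
    fix g :: "'u top_mor" and I :: "'u set" and f i
    assume g: "g \<in> Mor Top" and K: "(I, f) \<in> K_Top (Cod Top g)" and i: "i \<in> I"
    then have "f i \<in> Mor Top" "tgt (f i) = tgt g" unfolding K_Top_def family_on_def by auto
    then show "\<exists>p q. is_pullback Top (f i) g p q" using Top_pullback_exists[OF U _ g] by metis
  next
    fix g :: "'u top_mor" and I :: "'u set" and f p q
    assume "g \<in> Mor Top" "(I, f) \<in> K_Top (Cod Top g)"
      "\<forall>i\<in>I. is_pullback Top (f i) g (p i) (q i)"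
    then show "(I, q) \<in> K_Top (Dom Top g)" using K_Top_stable by simp
  next
    fix I :: "'u set" and J :: "'u \<Rightarrow> 'u set"
    have "inj_on p (SIGMA i:I. J i)" using p by (rule inj_on_subset) simp
    then have "bij_betw (inv_into (SIGMA i:I. J i) p) (p ` (SIGMA i:I. J i)) (SIGMA i:I. J i)"
      by (intro bij_betw_inv_into inj_on_imp_bij_betw)
    then show "\<exists>L b. bij_betw (b :: 'u \<Rightarrow> 'u \<times> 'u) L (SIGMA i:I. J i)" by blast
  next
    fix X :: "'u topology" and I :: "'u set" and f J g L and b :: "'u \<Rightarrow> 'u \<times> 'u" and h
    assume "X \<in> Obj Top" "(I, f) \<in> K_Top X \<and> (\<forall>i\<in>I. (J i, g i) \<in> K_Top (Dom Top (f i)))"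
      "bij_betw b L (SIGMA i:I. J i) \<and>
        (\<forall>l\<in>L. \<forall>i j. b l = (i, j) \<longrightarrow> h l = Comp Top (f i) (g i j))"
    then show "(L, h) \<in> K_Top X" using K_Top_compose[of X I f J g b L h] by simp
  qed
qed

end

theorem proposition4p6:
  assumes "universe TYPE('u)"
  shows
    "(grothendieck_basis (Top :: ('u topology, 'u top_mor) cat) K_Top \<and>
      is_canonical_topology (Top :: ('u topology, 'u top_mor) cat) (generated_topology Top K_Top))
    \<and>
     (\<forall>(X :: 'u topology) S. sieve Top X S \<longrightarrow>
        (colim_sieve Top X S \<longleftrightarrow>
          (\<exists>F :: ('u, 'u top_mor) family. small (fst F) \<and> snd F ` fst F \<subseteq> S \<and>
             quotient_map (coprod_space F) X (coprod_map F))) \<and>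
        (universal_colim_sieve Top X S \<longleftrightarrow>
          (\<exists>F :: ('u, 'u top_mor) family. small (fst F) \<and> snd F ` fst F \<subseteq> S \<and>
             universal_quotient_map (coprod_space F) X (coprod_map F))))
    \<and>
     (\<forall>(X :: 'u topology) Y f. f \<in> hom Top Y X \<longrightarrow>
        (colim_sieve Top X (generated_sieve Top {f}) \<longleftrightarrow> quotient_map Y X (fn f)) \<and>
        (universal_colim_sieve Top X (generated_sieve Top {f}) \<longleftrightarrow>
          universal_quotient_map Y X (fn f)))"
proof (rule conjI[OF _ conjI])
  show "grothendieck_basis (Top :: ('u topology, 'u top_mor) cat) K_Top \<and>
      is_canonical_topology (Top :: ('u topology, 'u top_mor) cat) (generated_topology Top K_Top)"
    using grothendieck_basis_K_Top[OF assms] generated_topology_K_Top_canonical[OF assms] ..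
  show "\<forall>(X :: 'u topology) S. sieve Top X S \<longrightarrow>
        (colim_sieve Top X S \<longleftrightarrow>
          (\<exists>F :: ('u, 'u top_mor) family. small (fst F) \<and> snd F ` fst F \<subseteq> S \<and>
             quotient_map (coprod_space F) X (coprod_map F))) \<and>
        (universal_colim_sieve Top X S \<longleftrightarrow>
          (\<exists>F :: ('u, 'u top_mor) family. small (fst F) \<and> snd F ` fst F \<subseteq> S \<and>
             universal_quotient_map (coprod_space F) X (coprod_map F)))"
    using colim_sieve_iff_quotient_family[OF assms]
      universal_colim_sieve_iff_universal_quotient_family[OF assms] by simp
  show "\<forall>(X :: 'u topology) Y f. f \<in> hom Top Y X \<longrightarrow>
        (colim_sieve Top X (generated_sieve Top {f}) \<longleftrightarrow> quotient_map Y X (fn f)) \<and>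
        (universal_colim_sieve Top X (generated_sieve Top {f}) \<longleftrightarrow>
          universal_quotient_map Y X (fn f))"
  proof (intro allI impI)
    fix X Y :: "'u topology" and f assume "f \<in> hom Top Y X"
    then have f: "f \<in> Mor Top" "src f = Y" "tgt f = X" unfolding hom_def by auto
    have T: "sieve Top X (generated_sieve Top {f})"
      using sieve_generated[OF category_Top, of X "{f}"] f Mor_TopD(2)[OF f(1)] by simp
    have "colim_sieve Top X (generated_sieve Top {f}) \<longleftrightarrow> quotient_map Y X (fn f)"
      using colim_sieve_iff_final_cover[OF assms T] final_cover_generated_sieve[of "{f}" X]
        quotient_map_iff_final_cover[OF f(1)] f by simp
    moreover have "universal_colim_sieve Top X (generated_sieve Top {f}) \<longleftrightarrow>
        universal_quotient_map Y X (fn f)"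
      using universal_quotient_map_iff[OF assms f(1)] f by simp
    ultimately show "(colim_sieve Top X (generated_sieve Top {f}) \<longleftrightarrow> quotient_map Y X (fn f)) \<and>
        (universal_colim_sieve Top X (generated_sieve Top {f}) \<longleftrightarrow> universal_quotient_map Y X (fn f))" ..
  qed
qed

end
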